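(* Let $i\in\mathbb{N}$ (so $i\ge 1$) and let $c_{(\theta_0,\ldots,\theta_i)}:(\mathbb{K},S)\to(\mathbb{K}^2,0)$ be a multicusp. Then, as $\mathbb{K}$-vector spaces, $$\frac{m_0^i\theta_0(2)}{m_0^{i+1}\theta_0(2)}=\bigoplus_{j=0}^{i}\ker\left({}_i\overline{\omega}\,c_{\hat{\theta}_j}\right),$$ i.e. the kernels of the maps ${}_i\overline{\omega}\,c_{\hat{\theta}_j}$, $0\le j\le i$, are subspaces of $m_0^i\theta_0(2)/m_0^{i+1}\theta_0(2)$ whose sum is the whole space and is direct.
   Context: $\mathbb{K}=\mathbb{R}$ or $\mathbb{C}$; all germs are $C^\infty$ (if $\mathbb{K}=\mathbb{R}$) or holomorphic (if $\mathbb{K}=\mathbb{C}$). For a finite set $S\subset\mathbb{K}^n$, $C_S$ is the algebra of function germs $(\mathbb{K}^n,S)\to\mathbb{K}$, and $C_0$ that of germs $(\mathbb{K}^p,0)\to\mathbb{K}$; $m_0^\ell\subset C_0$ is the ideal of germs whose Taylor series vanish up to order $\ell-1$ ($m_0^0=C_0$). For a multigerm $f:(\mathbb{K}^n,S)\to(\mathbb{K}^p,0)$: $\theta_S(f)\cong C_S^{\,p}$ is the $C_S$-module of vector fields along $f$; $\theta_S(n)=\theta_S(\mathrm{id}_{(\mathbb{K}^n,S)})$, $\theta_0(p)=\theta_{\{0\}}(\mathrm{id}_{(\mathbb{K}^p,0)})\cong C_0^{\,p}$; $f^*u=u\circ f$; $f^*m_0^\ell\,\theta_S(f)$ denotes the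 $C_S$-submodule of $\theta_S(f)$ generated by $\{(u\circ f)\,v: u\in m_0^\ell, v\in\theta_S(f)\}$; $tf(\eta)=df\circ\eta$ for $\eta\in\theta_S(n)$, $\omega f(\xi)=\xi\circ f$ for $\xi\in\theta_0(p)$; $T\mathcal{R}_e(f)=tf(\theta_S(n))$. For $i\ge0$ the $\mathbb{K}$-linear map $${}_i\overline{\omega}f:\frac{m_0^i\theta_0(p)}{m_0^{i+1}\theta_0(p)}\to\frac{f^*m_0^i\theta_S(f)}{T\mathcal{R}_e(f)\cap f^*m_0^i\theta_S(f)+f^*m_0^{i+1}\theta_S(f)},\quad [\xi]\mapsto[\omega f(\xi)].$$ Multicusps: let $c(x)=(x^2,x^3)$ and $R_\theta$ the linear map of $\mathbb{K}^2$ with matrix $\begin{pmatrix}\cos\theta&-\sin\theta\\ \sin\theta&\cos\theta\end{pmatrix}$. Let $\theta_0,\ldots,\theta_i$ be real numbers with $0\le\theta_j<2\pi$ and $0\ne|\theta_j-\theta_k|\ne\pi$ for $j\ne k$. Let $S=\{s_0,\ldots,s_i\}\subset\mathbb{K}$ be distinct points and $c_{\theta_j}:(\mathbb{K},s_j)\to(\mathbb{K}^2,0)$, $c_{\theta_j}(x)=R_{\theta_j}(c(x-s_j))$. The multigerm $\{c_{\theta_0},\ldots,c_{\theta_i}\}:(\mathbb{K},S)\to(\mathbb{K}^2,0)$ is the multicusp $c_{(\theta_0,\ldots,\theta_i)}$. For $i\ge1$, $c_{\hat{\theta}_j}:(\mathbb{K},S\setminus\{s_j\})\to(\mathbb{K}^2,0)$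 is the multigerm obtained by removing the branch $c_{\theta_j}$. *)

theory Defs
  imports "HOL-Analysis.Analysis"
begin

text \<open>The field K is represented by a type 'k of class real_normed_field; the theorem
  is stated for both instances K = real and K = complex.  K^2 is 'k \<times> 'k.\<close>

definition pd1 :: "('k::real_normed_field \<times> 'k \<Rightarrow> 'k) \<Rightarrow> 'k \<times> 'k \<Rightarrow> 'k" where
  "pd1 g p = deriv (\<lambda>t. g (t, snd p)) (fst p)"

definition pd2 :: "('k::real_normed_field \<times> 'k \<Rightarrow> 'k) \<Rightarrow> 'k \<times> 'k \<Rightarrow> 'k" where
  "pd2 g p = deriv (\<lambda>t. g (fst p, t)) (snd p)"

fun ipd :: "bool list \<Rightarrow> ('k::real_normed_field \<times> 'k \<Rightarrow> 'k) \<Rightarrow> 'k \<times> 'k \<Rightarrow> 'k" where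
  "ipd [] g = g"
| "ipd (b # ds) g = (if b then pd1 (ipd ds g) else pd2 (ipd ds g))"

text \<open>C-infinity (K = R) resp. holomorphic (K = C) on an open set: all iterated partial
  derivatives (w.r.t. the field K) exist and are continuous.\<close>
definition smooth2_on :: "('k::real_normed_field \<times> 'k) set \<Rightarrow> ('k \<times> 'k \<Rightarrow> 'k) \<Rightarrow> bool" where
  "smooth2_on U g \<longleftrightarrow> open U \<and>
     (\<forall>ds. continuous_on U (ipd ds g) \<and>
        (\<forall>p\<in>U. ((\<lambda>t. ipd ds g (t, snd p)) has_field_derivative pd1 (ipd ds g) p) (at (fst p)) \<and>
                ((\<lambda>t. ipd ds g (fst p, t)) has_field_derivative pd2 (ipd ds g) p) (at (snd p))))"

definition germ0 :: "('k::real_normed_field \<times> 'k \<Rightarrow> 'k) \<Rightarrow> bool" where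
  "germ0 g \<longleftrightarrow> (\<exists>U. (0, 0) \<in> U \<and> smooth2_on U g)"

text \<open>m_0^l: germs whose Taylor series vanish up to order l-1\<close>
definition mpow :: "nat \<Rightarrow> ('k::real_normed_field \<times> 'k \<Rightarrow> 'k) set" where
  "mpow l = {g. germ0 g \<and> (\<forall>ds. length ds < l \<longrightarrow> ipd ds g (0, 0) = 0)}"

definition mpow_vf :: "nat \<Rightarrow> ('k::real_normed_field \<times> 'k \<Rightarrow> 'k \<times> 'k) set" where
  "mpow_vf l = {\<xi>. (\<lambda>p. fst (\<xi> p)) \<in> mpow l \<and> (\<lambda>p. snd (\<xi> p)) \<in> mpow l}"

definition smooth1_on :: "'k::real_normed_field set \<Rightarrow> ('k \<Rightarrow> 'k) \<Rightarrow> bool" where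
  "smooth1_on U h \<longleftrightarrow> open U \<and>
     (\<forall>n. \<forall>x\<in>U. ((deriv ^^ n) h has_field_derivative (deriv ^^ Suc n) h x) (at x))"

definition germS :: "'k::real_normed_field set \<Rightarrow> ('k \<Rightarrow> 'k) \<Rightarrow> bool" where
  "germS S h \<longleftrightarrow> (\<exists>U. S \<subseteq> U \<and> smooth1_on U h)"

definition germS_vf :: "'k::real_normed_field set \<Rightarrow> ('k \<Rightarrow> 'k \<times> 'k) \<Rightarrow> bool" where
  "germS_vf S w \<longleftrightarrow> germS S (\<lambda>x. fst (w x)) \<and> germS S (\<lambda>x. snd (w x))"

definition germ_eq :: "'a::topological_space set \<Rightarrow> ('a \<Rightarrow> 'b) \<Rightarrow> ('a \<Rightarrow> 'b) \<Rightarrow> bool" where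
  "germ_eq S a b \<longleftrightarrow> (\<exists>U. open U \<and> S \<subseteq> U \<and> (\<forall>x\<in>U. a x = b x))"

definition smult_pair :: "'k::real_normed_field \<Rightarrow> 'k \<times> 'k \<Rightarrow> 'k \<times> 'k" where
  "smult_pair a p = (a * fst p, a * snd p)"

definition tf :: "('k::real_normed_field \<Rightarrow> 'k \<times> 'k) \<Rightarrow> ('k \<Rightarrow> 'k) \<Rightarrow> 'k \<Rightarrow> 'k \<times> 'k" where
  "tf f \<eta> = (\<lambda>x. (deriv (\<lambda>t. fst (f t)) x * \<eta> x, deriv (\<lambda>t. snd (f t)) x * \<eta> x))"

text \<open>f^* m_0^l theta_S(f): the C_S-submodule generated by (u o f) v, i.e. finite sums\<close>
definition pullback_mod :: "nat \<Rightarrow> 'k::real_normed_field set \<Rightarrow> ('k \<Rightarrow> 'k \<times> 'k) \<Rightarrow> ('k \<Rightarrow> 'k \<times> 'k) set" where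
  "pullback_mod l S f = {w. \<exists>(N::nat) u v. (\<forall>k<N. u k \<in> mpow l \<and> germS_vf S (v k)) \<and>
       germ_eq S w (\<lambda>x. \<Sum>k<N. smult_pair (u k (f x)) (v k x))}"

definition TRe :: "'k::real_normed_field set \<Rightarrow> ('k \<Rightarrow> 'k \<times> 'k) \<Rightarrow> ('k \<Rightarrow> 'k \<times> 'k) set" where
  "TRe S f = {w. \<exists>\<eta>. germS S \<eta> \<and> germ_eq S w (tf f \<eta>)}"

text \<open>Representatives xi in m_0^l theta_0(2) of the kernel of the map  l-omega-bar f,
  i.e. omega f(xi) lies in  T R_e(f) \<inter> f^*m_0^l theta_S(f) + f^*m_0^(l+1) theta_S(f).\<close>
definition ker_omega_bar :: "nat \<Rightarrow> 'k::real_normed_field set \<Rightarrow> ('k \<Rightarrow> 'k \<times> 'k) \<Rightarrow> ('k \<times> 'k \<Rightarrow> 'k \<times> 'k) set" where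
  "ker_omega_bar l S f = {\<xi> \<in> mpow_vf l. \<exists>a b. a \<in> TRe S f \<inter> pullback_mod l S f \<and>
       b \<in> pullback_mod (Suc l) S f \<and> germ_eq S (\<lambda>x. \<xi> (f x)) (\<lambda>x. a x + b x)}"

text \<open>m_0^l theta_0(2) / m_0^(l+1) theta_0(2) is the internal direct sum of the images of
  the sets K j (j in J), written out on representatives.\<close>
definition graded_direct_sum :: "nat \<Rightarrow> (nat \<Rightarrow> ('k::real_normed_field \<times> 'k \<Rightarrow> 'k \<times> 'k) set) \<Rightarrow> nat set \<Rightarrow> bool" where
  "graded_direct_sum l K J \<longleftrightarrow>
     (\<forall>j\<in>J. K j \<subseteq> mpow_vf l) \<and>
     (\<forall>\<xi>\<in>mpow_vf l. \<exists>\<xi>s. (\<forall>j\<in>J. \<xi>s j \<in> K j) \<and>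
         (\<lambda>p. \<xi> p - (\<Sum>j\<in>J. \<xi>s j p)) \<in> mpow_vf (Suc l)) \<and>
     (\<forall>\<xi>s. (\<forall>j\<in>J. \<xi>s j \<in> K j) \<and> (\<lambda>p. \<Sum>j\<in>J. \<xi>s j p) \<in> mpow_vf (Suc l) \<longrightarrow>
         (\<forall>j\<in>J. \<xi>s j \<in> mpow_vf (Suc l)))"

definition rot :: "real \<Rightarrow> 'k::real_normed_field \<times> 'k \<Rightarrow> 'k \<times> 'k" where
  "rot \<theta> p = (of_real (cos \<theta>) * fst p - of_real (sin \<theta>) * snd p,
              of_real (sin \<theta>) * fst p + of_real (cos \<theta>) * snd p)"

definition cusp :: "'k::real_normed_field \<Rightarrow> 'k \<times> 'k" where
  "cusp x = (x ^ 2, x ^ 3)"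

definition cusp_branch :: "real \<Rightarrow> 'k::real_normed_field \<Rightarrow> 'k \<Rightarrow> 'k \<times> 'k" where
  "cusp_branch \<theta> s x = rot \<theta> (cusp (x - s))"

definition multicusp_rep :: "nat \<Rightarrow> (nat \<Rightarrow> real) \<Rightarrow> (nat \<Rightarrow> 'k::real_normed_field) \<Rightarrow> ('k \<Rightarrow> 'k \<times> 'k) \<Rightarrow> bool" where
  "multicusp_rep i \<theta> s f \<longleftrightarrow>
     (\<forall>j\<le>i. eventually (\<lambda>x. f x = cusp_branch (\<theta> j) (s j) x) (nhds (s j)))"

end

theory Submission
  imports Defs "HOL-Computational_Algebra.Polynomial" "HOL-Library.Landau_Symbols"
begin

text \<open>
  Let \<open>P\<close> be the leading form, of degree \<open>i\<close>, of a vector field in \<open>m\<^sub>0\<^sup>i \<theta>\<^sub>0(2)\<close>, and let \<open>d\<^sub>k\<close> be the tangent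
  direction of the \<open>k\<close>-th cusp. Expanding in the local parameter shows that the class of \<open>P\<close> is in the kernel
  for that branch iff \<open>W(p) = 2 div P(p) p - (2i + 3) P(p)\<close> vanishes at \<open>d\<^sub>k\<close>. The map \<open>P \<mapsto> W\<close> is an automorphism of
  the space of vector-valued forms of degree \<open>i\<close>, because \<open>div W = - div P\<close> by Euler's identity. Hence the
  kernels correspond to the forms \<open>W\<close> vanishing at all but one of \<open>i + 1\<close> pairwise independent directions, and
  the decomposition is Lagrange interpolation for binary forms.
\<close>

section \<open>Smooth germs in two variables\<close>

text \<open>In the local parameter t a branch is t^2 (d + t n), with n the unit normal of d, and its
  derivative is t (2 d + 3 t n). Composing P, of degree i, with the branch gives t^(2i) P(d + t n),
  while fields in f^* m_0^(i+1) have order at least 2i + 2 in t: only the coefficients of 1 and t in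
  P(d + t n) count. They must agree with those of (\<alpha> + \<beta> t) (2 d + 3 t n). Four
  coefficients against two free parameters leave two scalar conditions per branch, and the forms
  have dimension 2 (i + 1), which is why i + 1 branches fit exactly. The branches do not interact,
  because the points of S have disjoint neighbourhoods on which fields can be prescribed
  independently. The analytic obstacle is that a smooth real germ is not given by its Taylor series.
  Order of vanishing is therefore measured by norm estimates, valid over both fields, and only
  leading forms are ever extracted.\<close>

lemma eventually_section:
  fixes p :: "'a::t2_space \<times> 'b::t2_space"
  assumes "open U" "p \<in> U"
  shows "\<forall>\<^sub>F t in nhds (fst p). (t, snd p) \<in> U" "\<forall>\<^sub>F t in nhds (snd p). (fst p, t) \<in> U"
proof -
  have "isCont (\<lambda>t. (t, snd p)) (fst p)" "isCont (\<lambda>t. (fst p, t)) (snd p)"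
    by (intro continuous_intros)+
  then show "\<forall>\<^sub>F t in nhds (fst p). (t, snd p) \<in> U" "\<forall>\<^sub>F t in nhds (snd p). (fst p, t) \<in> U"
    using assms by (auto simp: continuous_at_open eventually_nhds; metis prod.collapse)+
qed

lemma pd_cong_on:
  assumes "open U" "\<And>q. q \<in> U \<Longrightarrow> g q = h q" "p \<in> U"
  shows "pd1 g p = pd1 h p" "pd2 g p = pd2 h p"
  unfolding pd1_def pd2_def
  by (intro deriv_cong_ev refl eventually_mono[OF eventually_section(1)[OF assms(1,3)]]
      eventually_mono[OF eventually_section(2)[OF assms(1,3)]] assms(2); simp)+

lemma ipd_cong_on:
  assumes "open U" "\<And>q. q \<in> U \<Longrightarrow> g q = h q" "p \<in> U"
  shows "ipd ds g p = ipd ds h p"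
  using assms(3)
proof (induction ds arbitrary: p)
  case (Cons b ds)
  then show ?case
    using pd_cong_on[OF assms(1), of "ipd ds g" "ipd ds h"] by simp
qed (simp add: assms)

lemma smooth2_onD:
  assumes "smooth2_on U g"
  shows "open U" "continuous_on U (ipd ds g)"
    "p \<in> U \<Longrightarrow> ((\<lambda>t. ipd ds g (t, snd p)) has_field_derivative pd1 (ipd ds g) p) (at (fst p))"
    "p \<in> U \<Longrightarrow> ((\<lambda>t. ipd ds g (fst p, t)) has_field_derivative pd2 (ipd ds g) p) (at (snd p))"
  using assms unfolding smooth2_on_def by auto

lemma smooth2_on_subset:
  "smooth2_on U g \<Longrightarrow> open V \<Longrightarrow> V \<subseteq> U \<Longrightarrow> smooth2_on V g"
  unfolding smooth2_on_def by (meson continuous_on_subset subsetD)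

lemma ipd_append: "ipd (ds @ es) g = ipd ds (ipd es g)"
  by (induction ds) auto

lemma smooth2_on_ipd: "smooth2_on U g \<Longrightarrow> smooth2_on U (ipd es g)"
  unfolding smooth2_on_def by (simp flip: ipd_append)

lemma smooth2_on_pd:
  assumes "smooth2_on U g"
  shows "smooth2_on U (pd1 g)" "smooth2_on U (pd2 g)"
  using smooth2_on_ipd[OF assms, of "[True]"] smooth2_on_ipd[OF assms, of "[False]"] by simp_all

text \<open>A family \<open>G\<close> indexed by words of derivatives and closed under
  differentiation certifies smoothness. This avoids differentiating iterated \<open>deriv\<close>
  terms directly each time a germ is built from others.\<close>

lemma smooth2_on_if_ipd_eq:
  assumes U: "open U" and eq: "\<And>ds p. p \<in> U \<Longrightarrow> ipd ds h p = G ds p"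
    and cont: "\<And>ds. continuous_on U (G ds)"
    and d1: "\<And>ds p. p \<in> U \<Longrightarrow> ((\<lambda>t. G ds (t, snd p)) has_field_derivative G (True # ds) p) (at (fst p))"
    and d2: "\<And>ds p. p \<in> U \<Longrightarrow> ((\<lambda>t. G ds (fst p, t)) has_field_derivative G (False # ds) p) (at (snd p))"
  shows "smooth2_on U h"
  unfolding smooth2_on_def
proof (intro conjI allI ballI)
  fix ds
  show "continuous_on U (ipd ds h)"
    using cont[of ds] by (rule continuous_on_eq) (simp add: eq)
  fix p assume p: "p \<in> U"
  have "pd1 (ipd ds h) p = G (True # ds) p" "pd2 (ipd ds h) p = G (False # ds) p"
    using eq[OF p, of "True # ds"] eq[OF p, of "False # ds"] by simp_all
  moreover have "\<forall>\<^sub>F t in nhds (fst p). ipd ds h (t, snd p) = G ds (t, snd p)"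
      "\<forall>\<^sub>F t in nhds (snd p). ipd ds h (fst p, t) = G ds (fst p, t)"
    using eventually_section[OF U p] by (auto elim!: eventually_mono simp: eq)
  ultimately show "((\<lambda>t. ipd ds h (t, snd p)) has_field_derivative pd1 (ipd ds h) p) (at (fst p))"
      "((\<lambda>t. ipd ds h (fst p, t)) has_field_derivative pd2 (ipd ds h) p) (at (snd p))"
    using d1[OF p, of ds] d2[OF p, of ds] by (simp_all add: DERIV_cong_ev)
qed (fact U)

lemma smooth2_on_cong:
  assumes "smooth2_on U g" "\<And>q. q \<in> U \<Longrightarrow> g q = h q"
  shows "smooth2_on U h"
  using smooth2_onD[OF assms(1)] ipd_cong_on[OF smooth2_onD(1)[OF assms(1)], of g h] assms(2)
  by (intro smooth2_on_if_ipd_eq[where G = "\<lambda>ds. ipd ds g"]) auto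

lemma ipd_lincomb:
  assumes "smooth2_on U g" "smooth2_on U h" "p \<in> U"
  shows "ipd ds (\<lambda>p. a * g p + b * h p) p = a * ipd ds g p + b * ipd ds h p"
  using assms(3)
proof (induction ds arbitrary: p)
  case (Cons c ds)
  note g = smooth2_onD[OF assms(1)] and h = smooth2_onD[OF assms(2)]
  have "pd1 (ipd ds (\<lambda>p. a * g p + b * h p)) p = pd1 (\<lambda>p. a * ipd ds g p + b * ipd ds h p) p"
      "pd2 (ipd ds (\<lambda>p. a * g p + b * h p)) p = pd2 (\<lambda>p. a * ipd ds g p + b * ipd ds h p) p"
    using pd_cong_on[OF g(1) Cons.IH Cons.prems] by auto
  moreover have "pd1 (\<lambda>p. a * ipd ds g p + b * ipd ds h p) p = a * pd1 (ipd ds g) p + b * pd1 (ipd ds h) p"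
    unfolding pd1_def[of "\<lambda>p. a * ipd ds g p + b * ipd ds h p"]
    by (intro DERIV_imp_deriv DERIV_add DERIV_cmult g(3) h(3) Cons.prems)
  moreover have "pd2 (\<lambda>p. a * ipd ds g p + b * ipd ds h p) p = a * pd2 (ipd ds g) p + b * pd2 (ipd ds h) p"
    unfolding pd2_def[of "\<lambda>p. a * ipd ds g p + b * ipd ds h p"]
    by (intro DERIV_imp_deriv DERIV_add DERIV_cmult g(4) h(4) Cons.prems)
  ultimately show ?case by simp
qed simp

lemma smooth2_on_lincomb:
  assumes "smooth2_on U g" "smooth2_on U h"
  shows "smooth2_on U (\<lambda>p. a * g p + b * h p)"
proof -
  note g = smooth2_onD[OF assms(1)] and h = smooth2_onD[OF assms(2)]
  show ?thesis
    by (rule smooth2_on_if_ipd_eq[where G = "\<lambda>ds p. a * ipd ds g p + b * ipd ds h p"])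
      (auto simp: ipd_lincomb[OF assms] g(1) intro!: continuous_intros g(2-) h(2-) DERIV_add DERIV_cmult)
qed

section \<open>The filtration of germs by powers of the maximal ideal\<close>

lemma mpowE:
  assumes "g \<in> mpow l"
  obtains U where "(0, 0) \<in> U" "open U" "smooth2_on U g"
  using assms unfolding mpow_def germ0_def smooth2_on_def by blast

lemma mpowI:
  assumes "smooth2_on U g" "(0, 0) \<in> U" "\<And>ds. length ds < l \<Longrightarrow> ipd ds g (0, 0) = 0"
  shows "g \<in> mpow l"
  using assms unfolding mpow_def germ0_def by blast

lemma mpowD: "g \<in> mpow l \<Longrightarrow> length ds < l \<Longrightarrow> ipd ds g (0, 0) = 0"
  unfolding mpow_def by auto

lemma mpow_cong:
  assumes "g \<in> mpow l" "open U" "(0, 0) \<in> U" "\<And>q. q \<in> U \<Longrightarrow> g q = h q"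
  shows "h \<in> mpow l"
proof -
  obtain V where V: "(0, 0) \<in> V" "open V" "smooth2_on V g" using mpowE assms(1) by blast
  have "smooth2_on (U \<inter> V) h"
    using V assms by (intro smooth2_on_cong[OF smooth2_on_subset[OF V(3)]]) auto
  then show ?thesis
    using mpowD[OF assms(1)] ipd_cong_on[OF assms(2,4,3)] V assms(3)
    by (intro mpowI[of "U \<inter> V"]) auto
qed

lemma mpow_lincomb:
  assumes "g \<in> mpow l" "h \<in> mpow l"
  shows "(\<lambda>p. a * g p + b * h p) \<in> mpow l"
proof -
  obtain U V where U: "(0, 0) \<in> U" "open U" "smooth2_on U g" and V: "(0, 0) \<in> V" "open V" "smooth2_on V h"
    using mpowE assms by meson
  have "smooth2_on (U \<inter> V) g" "smooth2_on (U \<inter> V) h"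
    using U V by (auto intro: smooth2_on_subset)
  then show ?thesis
    using U V mpowD[OF assms(1)] mpowD[OF assms(2)]
    by (intro mpowI[of "U \<inter> V"] smooth2_on_lincomb) (auto simp: ipd_lincomb)
qed

lemma mpow_add: "g \<in> mpow l \<Longrightarrow> h \<in> mpow l \<Longrightarrow> (\<lambda>p. g p + h p) \<in> mpow l"
  using mpow_lincomb[of g l h 1 1] by simp

lemma mpow_diff: "g \<in> mpow l \<Longrightarrow> h \<in> mpow l \<Longrightarrow> (\<lambda>p. g p - h p) \<in> mpow l"
  using mpow_lincomb[of g l h 1 "-1"] by simp

text \<open>The recursion behind all inductions on the order of vanishing. The last letter of a word
  is the derivative taken first, so words are split at their end.\<close>

lemma mpow_Suc_iff:
  "g \<in> mpow (Suc l) \<longleftrightarrow> germ0 g \<and> g (0, 0) = 0 \<and> pd1 g \<in> mpow l \<and> pd2 g \<in> mpow l"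
proof
  assume g: "g \<in> mpow (Suc l)"
  obtain U where U: "(0, 0) \<in> U" "open U" "smooth2_on U g" using mpowE g by blast
  have "ipd ds (pd1 g) (0, 0) = 0 \<and> ipd ds (pd2 g) (0, 0) = 0" if "length ds < l" for ds
    using mpowD[OF g, of "ds @ [True]"] mpowD[OF g, of "ds @ [False]"] that by (simp add: ipd_append)
  then show "germ0 g \<and> g (0, 0) = 0 \<and> pd1 g \<in> mpow l \<and> pd2 g \<in> mpow l"
    using mpowD[OF g, of "[]"] U smooth2_on_pd[OF U(3)]
    by (auto intro!: mpowI[of U] simp: germ0_def)
next
  assume g: "germ0 g \<and> g (0, 0) = 0 \<and> pd1 g \<in> mpow l \<and> pd2 g \<in> mpow l"
  have "ipd ds g (0, 0) = 0" if "length ds < Suc l" for ds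
  proof (cases ds rule: rev_cases)
    case (snoc es b)
    then show ?thesis
      using that g mpowD[of "pd1 g" l es] mpowD[of "pd2 g" l es] by (cases b) (auto simp: ipd_append)
  qed (use g in simp)
  then show "g \<in> mpow (Suc l)" using g by (simp add: mpow_def)
qed

lemma pd_diff:
  assumes "smooth2_on U g" "smooth2_on U h" "p \<in> U"
  shows "pd1 (\<lambda>p. g p - h p) p = pd1 g p - pd1 h p" "pd2 (\<lambda>p. g p - h p) p = pd2 g p - pd2 h p"
  using ipd_lincomb[OF assms, of "[True]" 1 "-1"] ipd_lincomb[OF assms, of "[False]" 1 "-1"] by simp_all

section \<open>Mixed partial derivatives and growth estimates\<close>

lemma box_subset:
  fixes p :: "'k::real_normed_field \<times> 'k"
  assumes "open U" "p \<in> U"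
  obtains r where "r > 0" "ball (fst p) r \<times> ball (snd p) r \<subseteq> U"
proof -
  obtain A B where AB: "open A" "open B" "fst p \<in> A" "snd p \<in> B" "A \<times> B \<subseteq> U"
    using open_prod_elim[OF assms] by (metis mem_Times_iff)
  obtain r1 r2 where r: "r1 > 0" "ball (fst p) r1 \<subseteq> A" "r2 > 0" "ball (snd p) r2 \<subseteq> B"
    using AB by (meson open_contains_ball)
  then show thesis
    using AB by (intro that[of "min r1 r2"]) (auto simp: subset_iff)
qed

lemma open_preimage_ball:
  assumes "open U" "continuous_on U f"
  shows "open {q \<in> U. f q \<in> ball c e}"
  using continuous_open_preimage[OF assms(2,1) open_ball, of c e] by (simp add: vimage_def Int_def)

text \<open>Subtracting the function A x y, whose mixed derivative is A, leaves a mixed derivative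
  of norm at most e. The Lipschitz bound is applied to \<open>g1 x\<close> in the second variable
  and then to the resulting difference in the first.\<close>

lemma second_difference_bound:
  fixes g :: "'k::real_normed_field \<times> 'k \<Rightarrow> 'k"
  assumes "r > 0" and h: "norm h < r"
    and gx: "\<And>x y. x \<in> ball a r \<Longrightarrow> y \<in> ball b r \<Longrightarrow> ((\<lambda>t. g (t, y)) has_field_derivative g1 x y) (at x)"
    and gxy: "\<And>x y. x \<in> ball a r \<Longrightarrow> y \<in> ball b r \<Longrightarrow> (g1 x has_field_derivative g12 x y) (at y)"
    and bnd: "\<And>x y. x \<in> ball a r \<Longrightarrow> y \<in> ball b r \<Longrightarrow> norm (g12 x y - A) \<le> e"
  shows "norm (g (a + h, b + h) - g (a + h, b) - g (a, b + h) + g (a, b) - A * h * h) \<le> e * norm h * norm h"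
proof -
  have b: "b \<in> ball b r" "b + h \<in> ball b r" and a: "a \<in> ball a r" "a + h \<in> ball a r"
    using assms(1) h by (auto simp: dist_norm)
  have 1: "norm (g1 x (b + h) - g1 x b - A * h) \<le> e * norm h" if x: "x \<in> ball a r" for x
  proof -
    have "norm ((g1 x (b + h) - A * (b + h)) - (g1 x b - A * b)) \<le> e * norm (b + h - b)"
      using x bnd b gxy
      by (intro field_differentiable_bound[OF convex_ball, where f' = "\<lambda>y. g12 x y - A"])
        (auto intro!: derivative_eq_intros has_field_derivative_at_within[OF gxy])
    then show ?thesis by (simp add: algebra_simps)
  qed
  have "norm ((g (a + h, b + h) - g (a + h, b) - A * h * (a + h)) - (g (a, b + h) - g (a, b) - A * h * a))
      \<le> (e * norm h) * norm (a + h - a)"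
    using 1 a b
    by (intro field_differentiable_bound[OF convex_ball, where f' = "\<lambda>x. g1 x (b + h) - g1 x b - A * h"])
      (auto intro!: derivative_eq_intros has_field_derivative_at_within[OF gx])
  then show ?thesis by (simp add: algebra_simps)
qed

lemma eq_if_arbitrarily_close:
  fixes x y :: "'a::real_normed_vector"
  assumes "\<And>e. e > 0 \<Longrightarrow> norm (x - y) \<le> e"
  shows "x = y"
  using field_le_epsilon[of "norm (x - y)" 0] assms by simp

text \<open>Clairaut's theorem, with the mean value theorem replaced by a Lipschitz bound so that it
  holds for complex derivatives as well.\<close>

lemma pd_commute:
  fixes g :: "'k::real_normed_field \<times> 'k \<Rightarrow> 'k"
  assumes "smooth2_on U g" "p \<in> U"
  shows "pd1 (pd2 g) p = pd2 (pd1 g) p"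
proof (rule eq_if_arbitrarily_close)
  fix e :: real assume e: "e > 0"
  note g = smooth2_onD[OF assms(1)]
  define A B where "A = pd2 (pd1 g) p" and "B = pd1 (pd2 g) p"
  define V where "V = {q \<in> U. pd2 (pd1 g) q \<in> ball A (e/2)} \<inter> {q \<in> U. pd1 (pd2 g) q \<in> ball B (e/2)}"
  have "continuous_on U (pd2 (pd1 g))" "continuous_on U (pd1 (pd2 g))"
    using g(2)[of "[False, True]"] g(2)[of "[True, False]"] by simp_all
  then have "open {q \<in> U. pd2 (pd1 g) q \<in> ball A (e/2)}" "open {q \<in> U. pd1 (pd2 g) q \<in> ball B (e/2)}"
    using open_preimage_ball[OF g(1)] by blast+
  then have "open V" "p \<in> V" using e assms(2) by (auto simp: V_def A_def B_def)
  then obtain r where r: "r > 0" "ball (fst p) r \<times> ball (snd p) r \<subseteq> V" using box_subset by blast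
  \<comment> \<open>A nonzero increment shorter than r; as the image of a real number it exists in
    either field.\<close>
  define h :: 'k where "h = of_real (r/2)"
  have h: "norm h < r" "h \<noteq> 0" using r by (auto simp: h_def norm_divide)
  define D where "D = g (fst p + h, snd p + h) - g (fst p + h, snd p) - g (fst p, snd p + h) + g p"
  have V: "(x, y) \<in> U" "norm (pd2 (pd1 g) (x, y) - A) \<le> e/2" "norm (pd1 (pd2 g) (x, y) - B) \<le> e/2"
    if "x \<in> ball (fst p) r" "y \<in> ball (snd p) r" for x y
    using r(2) that by (force simp: V_def dist_norm norm_minus_commute)+
  have "norm (g (fst p + h, snd p + h) - g (fst p + h, snd p) - g (fst p, snd p + h) + g (fst p, snd p) - A * h * h)
      \<le> e/2 * norm h * norm h"
    using V g(3)[where ds = "[]"] g(4)[where ds = "[True]"]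
    by (intro second_difference_bound[OF r(1) h(1), where ?g1.0 = "\<lambda>x y. pd1 g (x, y)"
          and ?g12.0 = "\<lambda>x y. pd2 (pd1 g) (x, y)"]) force+
  \<comment> \<open>The same second difference with the roles of the coordinates exchanged, now
    compared with the other mixed derivative.\<close>
  moreover have "norm (g (fst p + h, snd p + h) - g (fst p, snd p + h) - g (fst p + h, snd p) + g (fst p, snd p) - B * h * h)
      \<le> e/2 * norm h * norm h"
    using V g(4)[where ds = "[]"] g(3)[where ds = "[False]"]
      second_difference_bound[OF r(1) h(1), where g = "\<lambda>(y, x). g (x, y)" and ?g1.0 = "\<lambda>y x. pd2 g (x, y)"
          and ?g12.0 = "\<lambda>y x. pd1 (pd2 g) (x, y)" and a = "snd p" and b = "fst p" and A = B and e = "e/2"]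
    by force
  ultimately have "norm (D - A * h * h) \<le> e/2 * norm h * norm h" "norm (D - B * h * h) \<le> e/2 * norm h * norm h"
    by (simp_all add: D_def algebra_simps)
  then have "norm ((D - A * h * h) - (D - B * h * h)) \<le> e * norm h * norm h"
    by (intro order_trans[OF norm_triangle_ineq4]) simp
  moreover have "(D - A * h * h) - (D - B * h * h) = (B - A) * (h * h)" by (simp add: algebra_simps)
  ultimately have "norm (B - A) * (norm h * norm h) \<le> e * (norm h * norm h)"
    by (simp add: norm_mult mult.assoc)
  then show "norm (pd1 (pd2 g) p - pd2 (pd1 g) p) \<le> e"
    using h(2) by (simp add: A_def B_def)
qed

text \<open>Taylor's estimate obtained without a remainder formula: the origin is joined to (x, y)
  through (0, y), and on each leg the induction hypothesis bounds the relevant partial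
  derivative.\<close>

lemma mpow_bound:
  fixes g :: "'k::real_normed_field \<times> 'k \<Rightarrow> 'k"
  assumes "g \<in> mpow l"
  shows "\<exists>C r. r > 0 \<and> C \<ge> 0 \<and> (\<forall>x y. norm x < r \<longrightarrow> norm y < r \<longrightarrow> norm (g (x, y)) \<le> C * (norm x + norm y) ^ l)"
  using assms
proof (induction l arbitrary: g)
  case 0
  obtain U where U: "(0, 0) \<in> U" "open U" "smooth2_on U g" using mpowE 0 by blast
  have "continuous_on U g" using smooth2_onD(2)[OF U(3), of "[]"] by simp
  then have "open {q \<in> U. g q \<in> ball (g (0, 0)) 1}"
    by (rule open_preimage_ball[OF U(2)])
  then obtain r where r: "r > 0" "ball 0 r \<times> ball 0 r \<subseteq> {q \<in> U. g q \<in> ball (g (0, 0)) 1}"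
    by (rule box_subset[of _ "(0, 0)"]) (use U(1) in auto)
  have "norm (g (x, y)) \<le> norm (g (0, 0)) + 1" if "norm x < r" "norm y < r" for x y
  proof -
    have "(x, y) \<in> ball 0 r \<times> ball 0 r" using that by simp
    then have "dist (g (0, 0)) (g (x, y)) < 1" using r(2) by (auto simp: subset_iff)
    then show ?thesis
      using norm_triangle_sub[of "g (x, y)" "g (0, 0)"] by (simp add: dist_norm norm_minus_commute)
  qed
  then show ?case using r(1) by (intro exI[of _ "norm (g (0, 0)) + 1"] exI[of _ r]) auto
next
  case (Suc l)
  obtain U where U: "(0, 0) \<in> U" "open U" "smooth2_on U g" using mpowE Suc by blast
  obtain r0 where r0: "r0 > 0" "ball 0 r0 \<times> ball 0 r0 \<subseteq> U" using box_subset[OF U(2,1)] by auto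
  obtain C1 r1 where 1: "r1 > 0" "C1 \<ge> 0"
    "\<And>x y. norm x < r1 \<Longrightarrow> norm y < r1 \<Longrightarrow> norm (pd1 g (x, y)) \<le> C1 * (norm x + norm y) ^ l"
    using Suc.IH[of "pd1 g"] Suc.prems by (auto simp: mpow_Suc_iff)
  obtain C2 r2 where 2: "r2 > 0" "C2 \<ge> 0"
    "\<And>x y. norm x < r2 \<Longrightarrow> norm y < r2 \<Longrightarrow> norm (pd2 g (x, y)) \<le> C2 * (norm x + norm y) ^ l"
    using Suc.IH[of "pd2 g"] Suc.prems by (auto simp: mpow_Suc_iff)
  define r where "r = min r0 (min r1 r2)"
  have "norm (g (x, y)) \<le> (C1 + C2) * (norm x + norm y) ^ Suc l" if xy: "norm x < r" "norm y < r" for x y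
  proof -
    have in_U: "(u, v) \<in> U" if "norm u \<le> norm x" "norm v \<le> norm y" for u v
      using that xy r0 by (auto simp: r_def subset_iff)
    \<comment> \<open>The closed ball of radius \<open>norm x\<close> is convex and contains 0 and
      x, and the bound on the derivative is largest on its boundary.\<close>
    have "norm (g (x, y) - g (0, y)) \<le> C1 * (norm x + norm y) ^ l * norm (x - 0)"
    proof (rule field_differentiable_bound[OF convex_cball[of 0 "norm x"], where f' = "\<lambda>t. pd1 g (t, y)"])
      fix t :: 'k assume t: "t \<in> cball 0 (norm x)"
      show "((\<lambda>t. g (t, y)) has_field_derivative pd1 g (t, y)) (at t within cball 0 (norm x))"
        using smooth2_onD(3)[OF U(3), of "(t, y)" "[]"] in_U[of t y] t by (auto intro: has_field_derivative_at_within)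
      have "norm (pd1 g (t, y)) \<le> C1 * (norm t + norm y) ^ l"
        using t xy by (intro 1(3)) (auto simp: r_def)
      also have "\<dots> \<le> C1 * (norm x + norm y) ^ l"
        using t 1(2) by (intro mult_left_mono power_mono) auto
      finally show "norm (pd1 g (t, y)) \<le> C1 * (norm x + norm y) ^ l" .
    qed auto
    moreover have "norm (g (0, y) - g (0, 0)) \<le> C2 * (norm x + norm y) ^ l * norm (y - 0)"
    proof (rule field_differentiable_bound[OF convex_cball[of 0 "norm y"], where f' = "\<lambda>t. pd2 g (0, t)"])
      fix t :: 'k assume t: "t \<in> cball 0 (norm y)"
      show "((\<lambda>t. g (0, t)) has_field_derivative pd2 g (0, t)) (at t within cball 0 (norm y))"
        using smooth2_onD(4)[OF U(3), of "(0, t)" "[]"] in_U[of 0 t] t by (auto intro: has_field_derivative_at_within)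
      have "norm (pd2 g (0, t)) \<le> C2 * (norm (0::'k) + norm t) ^ l"
        using t xy 2(1) by (intro 2(3)) (auto simp: r_def)
      also have "\<dots> \<le> C2 * (norm x + norm y) ^ l"
        using t 2(2) by (intro mult_left_mono power_mono) (auto simp: add_increasing)
      finally show "norm (pd2 g (0, t)) \<le> C2 * (norm x + norm y) ^ l" .
    qed auto
    ultimately have "norm (g (x, y) - g (0, 0)) \<le> C1 * (norm x + norm y) ^ l * norm x + C2 * (norm x + norm y) ^ l * norm y"
      using norm_triangle_ineq[of "g (x, y) - g (0, y)" "g (0, y) - g (0, 0)"] by simp
    also have "\<dots> \<le> C1 * (norm x + norm y) ^ l * (norm x + norm y) + C2 * (norm x + norm y) ^ l * (norm x + norm y)"
      using 1(2) 2(2) by (intro add_mono mult_left_mono) auto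
    finally show ?thesis
      using Suc.prems by (simp add: mpow_Suc_iff algebra_simps)
  qed
  then show ?case
    using r0(1) 1(1,2) 2(1,2) by (intro exI[of _ "C1 + C2"] exI[of _ r]) (auto simp: r_def)
qed

section \<open>Homogeneous polynomials and leading forms\<close>

text \<open>Generated by constants, coordinate multiples and sums, so that scaling, derivatives,
  Euler's identity and restriction to lines all follow by rule induction without a choice of
  coefficients. The zero function has every degree.\<close>

inductive hom_poly :: "nat \<Rightarrow> ('k::real_normed_field \<times> 'k \<Rightarrow> 'k) \<Rightarrow> bool" where
  const: "hom_poly 0 (\<lambda>p. c)"
| fst_mult: "hom_poly l g \<Longrightarrow> hom_poly (Suc l) (\<lambda>p. fst p * g p)"
| snd_mult: "hom_poly l g \<Longrightarrow> hom_poly (Suc l) (\<lambda>p. snd p * g p)"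
| add: "hom_poly l g \<Longrightarrow> hom_poly l h \<Longrightarrow> hom_poly l (\<lambda>p. g p + h p)"

lemma hom_poly_zero: "hom_poly l (\<lambda>p. 0)"
proof (induction l)
  case (Suc l)
  then show ?case using hom_poly.fst_mult[OF Suc] by simp
qed (rule hom_poly.const)

lemma hom_poly_cmult: "hom_poly l g \<Longrightarrow> hom_poly l (\<lambda>p. c * g p)"
proof (induction rule: hom_poly.induct)
  case (fst_mult l g)
  then show ?case using hom_poly.fst_mult[of l "\<lambda>p. c * g p"] by (simp add: ac_simps)
next
  case (snd_mult l g)
  then show ?case using hom_poly.snd_mult[of l "\<lambda>p. c * g p"] by (simp add: ac_simps)
qed (auto simp: distrib_left intro: hom_poly.const hom_poly.add)

lemma hom_poly_diff: "hom_poly l g \<Longrightarrow> hom_poly l h \<Longrightarrow> hom_poly l (\<lambda>p. g p - h p)"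
  using hom_poly.add[OF _ hom_poly_cmult[of l h "-1"], of g] by simp

lemma hom_poly_linear_mult:
  assumes "hom_poly l g"
  shows "hom_poly (Suc l) (\<lambda>p. (a * fst p + b * snd p) * g p)"
  using hom_poly.add[OF hom_poly.fst_mult[OF hom_poly_cmult[OF assms, of a]]
      hom_poly.snd_mult[OF hom_poly_cmult[OF assms, of b]]]
  by (simp add: algebra_simps)

lemma hom_poly_prod:
  assumes "finite J"
  shows "hom_poly (card J) (\<lambda>p. \<Prod>j\<in>J. a j * fst p + b j * snd p)"
  using assms by (induction J) (auto intro: hom_poly.const hom_poly_linear_mult)

lemma hom_poly_scale: "hom_poly l g \<Longrightarrow> g (t * x, t * y) = t ^ l * g (x, y)"
  by (induction rule: hom_poly.induct) (auto simp: algebra_simps)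

lemma hom_poly_continuous: "hom_poly l g \<Longrightarrow> continuous_on A g"
  by (induction rule: hom_poly.induct) (auto intro!: continuous_intros)

lemma hom_poly_has_pd:
  assumes "hom_poly l g"
  shows "((\<lambda>t. g (t, snd p)) has_field_derivative pd1 g p) (at (fst p))"
    "((\<lambda>t. g (fst p, t)) has_field_derivative pd2 g p) (at (snd p))"
proof -
  have "(\<exists>D. ((\<lambda>t. g (t, snd p)) has_field_derivative D) (at (fst p))) \<and>
        (\<exists>D. ((\<lambda>t. g (fst p, t)) has_field_derivative D) (at (snd p)))"
    using assms
  proof (induction rule: hom_poly.induct)
    case (const c)
    show ?case by (auto intro: exI[of _ 0])
  next
    case (fst_mult l g)
    then show ?case using DERIV_mult[OF DERIV_ident] DERIV_cmult by fastforce
  next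
    case (snd_mult l g)
    then show ?case using DERIV_mult[OF DERIV_ident] DERIV_cmult by fastforce
  next
    case (add l g h)
    then show ?case using DERIV_add by blast
  qed
  then show "((\<lambda>t. g (t, snd p)) has_field_derivative pd1 g p) (at (fst p))"
    "((\<lambda>t. g (fst p, t)) has_field_derivative pd2 g p) (at (snd p))"
    unfolding pd1_def pd2_def by (auto dest: DERIV_imp_deriv)
qed

lemma pd_const: "pd1 (\<lambda>p. c) = (\<lambda>p. 0)" "pd2 (\<lambda>p. c) = (\<lambda>p. 0)"
  by (auto simp: pd1_def pd2_def)

lemma pd_mult_coord:
  assumes "hom_poly l g"
  shows "pd1 (\<lambda>p. fst p * g p) p = g p + fst p * pd1 g p" "pd2 (\<lambda>p. fst p * g p) p = fst p * pd2 g p"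
    "pd1 (\<lambda>p. snd p * g p) p = snd p * pd1 g p" "pd2 (\<lambda>p. snd p * g p) p = g p + snd p * pd2 g p"
  unfolding pd1_def[of "\<lambda>p. fst p * g p"] pd2_def[of "\<lambda>p. fst p * g p"]
    pd1_def[of "\<lambda>p. snd p * g p"] pd2_def[of "\<lambda>p. snd p * g p"]
  by (rule DERIV_imp_deriv; auto intro!: derivative_eq_intros hom_poly_has_pd[OF assms])+

lemma pd_add:
  assumes "hom_poly l g" "hom_poly m h"
  shows "pd1 (\<lambda>p. g p + h p) p = pd1 g p + pd1 h p" "pd2 (\<lambda>p. g p + h p) p = pd2 g p + pd2 h p"
  unfolding pd1_def[of "\<lambda>p. g p + h p"] pd2_def[of "\<lambda>p. g p + h p"]
  by (rule DERIV_imp_deriv; auto intro!: derivative_eq_intros hom_poly_has_pd[OF assms(1)] hom_poly_has_pd[OF assms(2)])+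

lemma pd_cmult:
  assumes "hom_poly l g"
  shows "pd1 (\<lambda>p. c * g p) p = c * pd1 g p" "pd2 (\<lambda>p. c * g p) p = c * pd2 g p"
  unfolding pd1_def[of "\<lambda>p. c * g p"] pd2_def[of "\<lambda>p. c * g p"]
  by (rule DERIV_imp_deriv; auto intro!: derivative_eq_intros hom_poly_has_pd[OF assms(1)])+

text \<open>Here \<open>g\<close> stands for a derivative of a form of degree l: it has degree l - 1
  or, for l = 0, is zero, and in both cases a coordinate multiple of it has degree l again.\<close>

lemma hom_poly_coord_mult_pred:
  assumes "l = 0 \<Longrightarrow> g = (\<lambda>p. 0)" "\<And>m. l = Suc m \<Longrightarrow> hom_poly m g"
  shows "hom_poly l (\<lambda>p. fst p * g p)" "hom_poly l (\<lambda>p. snd p * g p)"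
proof -
  have "hom_poly l (\<lambda>p. fst p * g p) \<and> hom_poly l (\<lambda>p. snd p * g p)"
  proof (cases l)
    case 0
    then show ?thesis using assms(1) hom_poly_zero by simp
  next
    case (Suc m)
    then show ?thesis using hom_poly.fst_mult[OF assms(2)] hom_poly.snd_mult[OF assms(2)] by simp
  qed
  then show "hom_poly l (\<lambda>p. fst p * g p)" "hom_poly l (\<lambda>p. snd p * g p)" by auto
qed

lemma hom_poly_pd_cases:
  assumes "hom_poly l g"
  shows "(l = 0 \<longrightarrow> pd1 g = (\<lambda>p. 0) \<and> pd2 g = (\<lambda>p. 0)) \<and> (\<forall>m. l = Suc m \<longrightarrow> hom_poly m (pd1 g) \<and> hom_poly m (pd2 g))"
  using assms
proof (induction rule: hom_poly.induct)
  case (const c)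
  show ?case by (simp add: pd_const)
next
  case (fst_mult l g)
  have "hom_poly l (\<lambda>p. fst p * pd1 g p)" "hom_poly l (\<lambda>p. fst p * pd2 g p)"
    by (rule hom_poly_coord_mult_pred(1), use fst_mult in simp, use fst_mult in simp)+
  then have "hom_poly l (\<lambda>p. g p + fst p * pd1 g p)" "hom_poly l (\<lambda>p. fst p * pd2 g p)"
    using fst_mult(1) by (simp_all add: hom_poly.add)
  then show ?case by (simp add: pd_mult_coord[OF fst_mult(1), abs_def])
next
  case (snd_mult l g)
  have "hom_poly l (\<lambda>p. snd p * pd1 g p)" "hom_poly l (\<lambda>p. snd p * pd2 g p)"
    by (rule hom_poly_coord_mult_pred(2), use snd_mult in simp, use snd_mult in simp)+
  then have "hom_poly l (\<lambda>p. g p + snd p * pd2 g p)" "hom_poly l (\<lambda>p. snd p * pd1 g p)"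
    using snd_mult(1) by (simp_all add: hom_poly.add)
  then show ?case by (simp add: pd_mult_coord[OF snd_mult(1), abs_def])
next
  case (add l g h)
  then show ?case by (auto simp: pd_add[OF add(1,2), abs_def] intro: hom_poly.add)
qed

lemma pd_hom_poly_0:
  assumes "hom_poly 0 g"
  shows "pd1 g = (\<lambda>p. 0)" "pd2 g = (\<lambda>p. 0)"
  using hom_poly_pd_cases[OF assms] by auto

lemma hom_poly_pd:
  assumes "hom_poly (Suc l) g"
  shows "hom_poly l (pd1 g)" "hom_poly l (pd2 g)"
  using hom_poly_pd_cases[OF assms] by auto

lemma euler_identity:
  "hom_poly l g \<Longrightarrow> fst p * pd1 g p + snd p * pd2 g p = of_nat l * g p"
proof (induction rule: hom_poly.induct)
  case (const c)
  show ?case by (simp add: pd_const)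
next
  case (fst_mult l g)
  have "fst p * (g p + fst p * pd1 g p) + snd p * (fst p * pd2 g p)
      = fst p * g p + fst p * (fst p * pd1 g p + snd p * pd2 g p)" by (simp add: algebra_simps)
  then show ?case unfolding pd_mult_coord[OF fst_mult(1)] fst_mult(2) by (simp add: algebra_simps)
next
  case (snd_mult l g)
  have "fst p * (snd p * pd1 g p) + snd p * (g p + snd p * pd2 g p)
      = snd p * g p + snd p * (fst p * pd1 g p + snd p * pd2 g p)" by (simp add: algebra_simps)
  then show ?case unfolding pd_mult_coord[OF snd_mult(1)] snd_mult(2) by (simp add: algebra_simps)
next
  case (add l g h)
  then show ?case unfolding pd_add[OF add(1,2)] by (simp add: algebra_simps)
qed

lemma hom_poly_ipd: "hom_poly l g \<Longrightarrow> \<exists>m. hom_poly m (ipd ds g)"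
proof (induction ds)
  case (Cons b ds)
  then obtain m where m: "hom_poly m (ipd ds g)" by blast
  show ?case
  proof (cases m)
    case 0
    then show ?thesis using m hom_poly_zero by (auto simp: pd_hom_poly_0)
  next
    case (Suc n)
    then show ?thesis using m hom_poly_pd[of n "ipd ds g"] by auto
  qed
qed auto

lemma hom_poly_smooth2_on:
  assumes "hom_poly l g"
  shows "smooth2_on UNIV g"
  unfolding smooth2_on_def
  using hom_poly_ipd[OF assms] hom_poly_has_pd hom_poly_continuous by blast

lemma hom_poly_germ0: "hom_poly l g \<Longrightarrow> germ0 g"
  unfolding germ0_def using hom_poly_smooth2_on by blast

lemma hom_poly_mpow: "hom_poly l g \<Longrightarrow> g \<in> mpow l"
proof (induction l arbitrary: g)
  case 0
  then show ?case using hom_poly_germ0 by (auto simp: mpow_def)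
next
  case (Suc l)
  then show ?case
    using Suc.IH[OF hom_poly_pd(1)] Suc.IH[OF hom_poly_pd(2)] hom_poly_germ0[OF Suc.prems]
      hom_poly_scale[OF Suc.prems, of 0 0 0] by (simp add: mpow_Suc_iff)
qed

text \<open>The top coefficient is the value at the direction of the line, its point at infinity,
  and serves to count zeros. The two lowest coefficients, the value and the directional derivative
  at the base point, serve the expansion along a cusp.\<close>

lemma hom_poly_on_line:
  assumes "hom_poly l g"
  obtains q where "degree q \<le> l" "coeff q l = g (u, v)" "coeff q 0 = g (x, y)"
    "coeff q 1 = u * pd1 g (x, y) + v * pd2 g (x, y)"
    "\<And>t. poly q t = g (x + t * u, y + t * v)"
proof -
  have "\<exists>q. degree q \<le> l \<and> coeff q l = g (u, v) \<and> coeff q 0 = g (x, y) \<and>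
      coeff q 1 = u * pd1 g (x, y) + v * pd2 g (x, y) \<and> (\<forall>t. poly q t = g (x + t * u, y + t * v))"
    using assms
  proof (induction rule: hom_poly.induct)
    case (const c)
    show ?case by (rule exI[of _ "[:c:]"]) (simp add: pd_const)
  next
    case (fst_mult l g)
    then obtain q where "degree q \<le> l" "coeff q l = g (u, v)" "coeff q 0 = g (x, y)"
      "coeff q 1 = u * pd1 g (x, y) + v * pd2 g (x, y)" "\<And>t. poly q t = g (x + t * u, y + t * v)"
      by blast
    \<comment> \<open>Otherwise the base point x would contribute to the top coefficient of the
      product.\<close>
    moreover have "coeff q (Suc l) = 0" using calculation(1) by (simp add: coeff_eq_0)
    moreover have "degree ([:x, u:] * q) \<le> Suc l"
      using degree_mult_le[of "[:x, u:]" q] degree_pCons_le[of x "[:u:]"] calculation(1) by simp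
    ultimately show ?case
      by (intro exI[of _ "[:x, u:] * q"]) (auto simp: pd_mult_coord[OF fst_mult(1)] algebra_simps)
  next
    case (snd_mult l g)
    then obtain q where "degree q \<le> l" "coeff q l = g (u, v)" "coeff q 0 = g (x, y)"
      "coeff q 1 = u * pd1 g (x, y) + v * pd2 g (x, y)" "\<And>t. poly q t = g (x + t * u, y + t * v)"
      by blast
    moreover have "coeff q (Suc l) = 0" using calculation(1) by (simp add: coeff_eq_0)
    moreover have "degree ([:y, v:] * q) \<le> Suc l"
      using degree_mult_le[of "[:y, v:]" q] degree_pCons_le[of y "[:v:]"] calculation(1) by simp
    ultimately show ?case
      by (intro exI[of _ "[:y, v:] * q"]) (auto simp: pd_mult_coord[OF snd_mult(1)] algebra_simps)
  next
    case (add l g h)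
    then obtain q r where "degree q \<le> l" "coeff q l = g (u, v)" "coeff q 0 = g (x, y)"
      "coeff q 1 = u * pd1 g (x, y) + v * pd2 g (x, y)" "\<And>t. poly q t = g (x + t * u, y + t * v)"
      "degree r \<le> l" "coeff r l = h (u, v)" "coeff r 0 = h (x, y)"
      "coeff r 1 = u * pd1 h (x, y) + v * pd2 h (x, y)" "\<And>t. poly r t = h (x + t * u, y + t * v)"
      by blast
    then show ?case
      by (intro exI[of _ "q + r"]) (auto simp: pd_add[OF add(1,2)] degree_add_le algebra_simps)
  qed
  then show thesis using that by blast
qed

section \<open>Zeros of binary forms\<close>

definition cross2 :: "'k::real_normed_field \<times> 'k \<Rightarrow> 'k \<times> 'k \<Rightarrow> 'k" where
  "cross2 p q = fst p * snd q - snd p * fst q"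

lemma cross2_eq_0_imp_parallel:
  assumes "cross2 d p = 0" "d \<noteq> (0, 0)"
  obtains c where "p = (c * fst d, c * snd d)"
proof (cases "fst d = 0")
  case True
  with assms show ?thesis
    by (intro that[of "snd p / snd d"]) (auto simp: cross2_def prod_eq_iff)
next
  case False
  with assms show ?thesis
    by (intro that[of "fst p / fst d"]) (auto simp: cross2_def prod_eq_iff field_simps)
qed

lemma hom_poly_zero_if_parallel:
  assumes "hom_poly l g" "g d = 0" "cross2 d p = 0" "d \<noteq> (0, 0)"
  shows "g p = 0"
  using assms(2) cross2_eq_0_imp_parallel[OF assms(3,4)] hom_poly_scale[OF assms(1), of _ "fst d" "snd d"]
  by (metis mult_zero_right prod.collapse)

text \<open>Restrict g to the line through p with direction \<open>d 0\<close>. It crosses the spans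
  of the other l directions at l distinct points, all roots, and the zero at \<open>d 0\<close>
  itself removes the coefficient of degree l. A polynomial of degree below l with l roots is
  zero.\<close>

lemma hom_poly_eq_0_if_many_zeros:
  assumes g: "hom_poly l g" and zero: "\<And>k. k \<le> l \<Longrightarrow> g (d k) = 0"
    and indep: "\<And>j k. j \<le> l \<Longrightarrow> k \<le> l \<Longrightarrow> j \<noteq> k \<Longrightarrow> cross2 (d j) (d k) \<noteq> 0"
    and nz: "\<And>k. k \<le> l \<Longrightarrow> d k \<noteq> (0, 0)"
  shows "g p = 0"
proof (cases "cross2 (d 0) p = 0")
  case True
  then show ?thesis using hom_poly_zero_if_parallel[OF g] zero nz by blast
next
  case False
  obtain q where q: "degree q \<le> l" "coeff q l = g (fst (d 0), snd (d 0))"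
    "\<And>t. poly q t = g (fst p + t * fst (d 0), snd p + t * snd (d 0))"
    using hom_poly_on_line[OF g, where u = "fst (d 0)" and v = "snd (d 0)" and x = "fst p" and y = "snd p"]
    by blast
  \<comment> \<open>The parameter at which the line meets the span of \<open>d k\<close>, solved
    from the vanishing of the determinant.\<close>
  define t where "t k = - cross2 (d k) p / cross2 (d k) (d 0)" for k
  have t: "cross2 (d k) p + t k * cross2 (d k) (d 0) = 0" if "k \<in> {1..l}" for k
    using indep[of k 0] that by (simp add: t_def)
  have root: "poly q (t k) = 0" if k: "k \<in> {1..l}" for k
    unfolding q(3)
  proof (rule hom_poly_zero_if_parallel[OF g, of "d k"])
    have "cross2 (d k) (fst p + t k * fst (d 0), snd p + t k * snd (d 0)) = cross2 (d k) p + t k * cross2 (d k) (d 0)"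
      by (simp add: cross2_def algebra_simps)
    then show "cross2 (d k) (fst p + t k * fst (d 0), snd p + t k * snd (d 0)) = 0" using t k by simp
  qed (use k zero nz in auto)
  have inj: "inj_on t {1..l}"
  proof (rule inj_onI, rule ccontr)
    fix j k assume jk: "j \<in> {1..l}" "k \<in> {1..l}" "t j = t k" "j \<noteq> k"
    \<comment> \<open>A point common to the spans of two independent directions is the origin; but
      then the line passes through the origin and p is parallel to \<open>d 0\<close>.\<close>
    define w where "w = (fst p + t k * fst (d 0), snd p + t k * snd (d 0))"
    have "cross2 (d j) w = cross2 (d j) p + t j * cross2 (d j) (d 0)" "cross2 (d k) w = cross2 (d k) p + t k * cross2 (d k) (d 0)"
      using jk(3) by (auto simp: cross2_def w_def algebra_simps)
    then have "cross2 (d j) w = 0" "cross2 (d k) w = 0" using t[OF jk(1)] t[OF jk(2)] by simp_all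
    moreover have "cross2 (d j) (d k) * fst w = fst (d k) * cross2 (d j) w - fst (d j) * cross2 (d k) w"
      "cross2 (d j) (d k) * snd w = snd (d k) * cross2 (d j) w - snd (d j) * cross2 (d k) w"
      by (simp_all add: cross2_def algebra_simps)
    ultimately have "fst w = 0" "snd w = 0" using indep[of j k] jk by auto
    moreover have "cross2 (d 0) p = cross2 (d 0) w" by (simp add: cross2_def w_def algebra_simps)
    ultimately show False using False by (simp add: cross2_def)
  qed
  have "q = 0"
  proof (rule ccontr)
    assume "q \<noteq> 0"
    have "card {1..l} \<le> card {x. poly q x = 0}"
      using inj root by (intro card_inj_on_le[of t]) (auto simp: poly_roots_finite[OF \<open>q \<noteq> 0\<close>])
    then have "degree q = l" using card_poly_roots_bound[OF \<open>q \<noteq> 0\<close>] q(1) by simp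
    then show False using \<open>q \<noteq> 0\<close> q(2) zero[of 0] by (metis leading_coeff_0_iff prod.collapse zero_le)
  qed
  then show ?thesis using q(3)[of 0] by simp
qed

section \<open>Uniqueness and existence of leading forms\<close>

lemma eq_0_if_norm_le_small:
  fixes a :: "'a::real_normed_vector" and C :: real
  assumes "r > 0" "\<And>t::real. 0 < t \<Longrightarrow> t < r \<Longrightarrow> norm a \<le> C * t"
  shows "a = 0"
proof -
  have "((\<lambda>t. C * t) \<longlongrightarrow> C * 0) (at_right (0::real))" by (intro tendsto_intros)
  moreover have "\<forall>\<^sub>F t in at_right (0::real). norm a \<le> C * t"
    using assms(2) eventually_at_right[OF assms(1)] assms(1) by blast
  ultimately have "norm a \<le> C * 0" by (intro tendsto_lowerbound) auto
  then show ?thesis by simp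
qed

text \<open>Along the ray t p homogeneity gives exactly t^l times the value at p, whereas membership
  forces order t^(l+1); letting t tend to 0 leaves zero. This makes leading forms unique.\<close>

lemma hom_poly_mpow_Suc_eq_0:
  fixes g :: "'k::real_normed_field \<times> 'k \<Rightarrow> 'k"
  assumes g: "hom_poly l g" and "g \<in> mpow (Suc l)"
  shows "g p = 0"
proof -
  obtain C r where C: "r > 0" "C \<ge> 0"
    "\<And>x y. norm x < r \<Longrightarrow> norm y < r \<Longrightarrow> norm (g (x, y)) \<le> C * (norm x + norm y) ^ Suc l"
    using mpow_bound[OF assms(2)] by blast
  define n where "n = norm (fst p) + norm (snd p)"
  have n: "n \<ge> 0" by (simp add: n_def)
  show ?thesis
  \<comment> \<open>This range of t keeps t p inside the box of the estimate; the added 1 covers p =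
    0.\<close>
  proof (rule eq_0_if_norm_le_small[of "r / (n + 1)" _ "C * n ^ Suc l"])
    fix t :: real assume t: "0 < t" "t < r / (n + 1)"
    then have tn: "t * (n + 1) < r" using n by (simp add: field_simps)
    have "t * norm (fst p) \<le> t * (n + 1)" "t * norm (snd p) \<le> t * (n + 1)"
      using t by (auto intro!: mult_left_mono simp: n_def)
    then have "t * norm (fst p) < r" "t * norm (snd p) < r" using tn by linarith+
    then have "norm (of_real t * fst p) < r" "norm (of_real t * snd p) < r"
      using t by (auto simp: norm_mult)
    from C(3)[OF this] have "t ^ l * norm (g p) \<le> C * (t * norm (fst p) + t * norm (snd p)) ^ Suc l"
      using t hom_poly_scale[OF g, of "of_real t" "fst p" "snd p"] by (simp add: norm_mult norm_power)
    also have "\<dots> = t ^ l * (C * n ^ Suc l * t)"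
      by (simp add: n_def power_mult_distrib flip: distrib_left)
    finally show "norm (g p) \<le> C * n ^ Suc l * t" using t by simp
  qed (use C(1) n in simp)
qed

text \<open>Both partial derivatives of a germ in \<open>m\<^sub>0\<^sup>l\<^sup>+\<^sup>1\<close> have leading forms by induction; by Clairaut's theorem
  these are the partial derivatives of a common form, which Euler's identity recovers.\<close>

lemma mpow_leading_form:
  fixes g :: "'k::real_normed_field \<times> 'k \<Rightarrow> 'k"
  assumes "g \<in> mpow l"
  shows "\<exists>h. hom_poly l h \<and> (\<lambda>p. g p - h p) \<in> mpow (Suc l)"
  using assms
proof (induction l arbitrary: g)
  case 0
  have c: "(\<lambda>p. g (0, 0)) \<in> mpow 0" by (intro hom_poly_mpow hom_poly.const)
  have "(\<lambda>p. g p - g (0, 0)) \<in> mpow 0" using 0 c by (rule mpow_diff)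
  then have "(\<lambda>p. g p - g (0, 0)) \<in> mpow (Suc 0)" by (auto simp: mpow_def)
  then show ?case using hom_poly.const by blast
next
  case (Suc l)
  obtain U where U: "(0, 0) \<in> U" "open U" "smooth2_on U g" using mpowE Suc by blast
  have pd: "pd1 g \<in> mpow l" "pd2 g \<in> mpow l" using Suc.prems by (auto simp: mpow_Suc_iff)
  obtain P Q where PQ: "hom_poly l P" "(\<lambda>p. pd1 g p - P p) \<in> mpow (Suc l)"
    "hom_poly l Q" "(\<lambda>p. pd2 g p - Q p) \<in> mpow (Suc l)"
    using Suc.IH[OF pd(1)] Suc.IH[OF pd(2)] by blast
  \<comment> \<open>By Clairaut the difference of the two sides lies in \<open>mpow l\<close>, and
    it is a form of degree l - 1, hence zero; for l = 0 both sides are derivatives of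
    constants.\<close>
  have closed: "pd2 P p = pd1 Q p" for p
  proof (cases l)
    case 0
    then show ?thesis using PQ pd_hom_poly_0 by metis
  next
    case (Suc m)
    have sm: "smooth2_on U P" "smooth2_on U Q"
      using smooth2_on_subset[OF hom_poly_smooth2_on U(2)] PQ by blast+
    have "(\<lambda>p. pd2 (\<lambda>p. pd1 g p - P p) p - pd1 (\<lambda>p. pd2 g p - Q p) p) \<in> mpow l"
      using PQ by (intro mpow_diff) (auto simp: mpow_Suc_iff)
    then have "(\<lambda>p. pd1 Q p - pd2 P p) \<in> mpow l"
      by (rule mpow_cong[OF _ U(2,1)])
        (simp add: pd_diff[OF smooth2_on_pd(1)[OF U(3)] sm(1)] pd_diff[OF smooth2_on_pd(2)[OF U(3)] sm(2)]
          pd_commute[OF U(3)])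
    moreover have "hom_poly m (\<lambda>p. pd1 Q p - pd2 P p)"
      using PQ Suc by (intro hom_poly_diff hom_poly_pd) auto
    ultimately show ?thesis using hom_poly_mpow_Suc_eq_0[of m "\<lambda>p. pd1 Q p - pd2 P p" p] Suc by simp
  qed
  have Sl: "of_nat (Suc l) \<noteq> (0::'k)" by (simp del: of_nat_Suc)
  define F where "F p = fst p * P p + snd p * Q p" for p
  define H where "H p = (1 / of_nat (Suc l)) * F p" for p
  note PQ' = hom_poly.fst_mult[OF PQ(1)] hom_poly.snd_mult[OF PQ(3)]
  have F: "hom_poly (Suc l) F" unfolding F_def using PQ' by (intro hom_poly.add)
  then have H: "hom_poly (Suc l) H" unfolding H_def by (rule hom_poly_cmult)
  \<comment> \<open>Closedness turns the mixed term y \<open>pd1 Q\<close> into y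
    \<open>pd2 P\<close>, and Euler's identity for P then gives l P beside the P from the product
    rule. The second component is symmetric.\<close>
  have "pd1 F p = of_nat (Suc l) * P p" "pd2 F p = of_nat (Suc l) * Q p" for p
    using euler_identity[OF PQ(1), of p] euler_identity[OF PQ(3), of p] closed[of p]
    unfolding F_def[abs_def] pd_add[OF PQ'] pd_mult_coord[OF PQ(1)] pd_mult_coord[OF PQ(3)]
    by (simp_all add: algebra_simps)
  then have pdH: "pd1 H p = P p" "pd2 H p = Q p" for p
    using Sl unfolding H_def[abs_def] pd_cmult[OF F] by simp_all
  have smH: "smooth2_on U H" using smooth2_on_subset[OF hom_poly_smooth2_on[OF H] U(2)] by blast
  have "(\<lambda>p. g p - H p) \<in> mpow (Suc l)"
    using Suc.prems hom_poly_mpow[OF H] by (rule mpow_diff)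
  moreover have "pd1 (\<lambda>p. g p - H p) \<in> mpow (Suc l)" "pd2 (\<lambda>p. g p - H p) \<in> mpow (Suc l)"
    using mpow_cong[OF PQ(2) U(2,1), of "pd1 (\<lambda>p. g p - H p)"] mpow_cong[OF PQ(4) U(2,1), of "pd2 (\<lambda>p. g p - H p)"]
      pd_diff[OF U(3) smH] pdH by auto
  ultimately have "(\<lambda>p. g p - H p) \<in> mpow (Suc (Suc l))"
    by (simp add: mpow_Suc_iff[of _ "Suc l"]) (simp add: mpow_Suc_iff)
  then show ?case using H by blast
qed

section \<open>The obstruction of a homogeneous vector field\<close>

definition hom_vf :: "nat \<Rightarrow> ('k::real_normed_field \<times> 'k \<Rightarrow> 'k \<times> 'k) \<Rightarrow> bool" where
  "hom_vf l P \<longleftrightarrow> hom_poly l (\<lambda>p. fst (P p)) \<and> hom_poly l (\<lambda>p. snd (P p))"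

definition dvg :: "('k::real_normed_field \<times> 'k \<Rightarrow> 'k \<times> 'k) \<Rightarrow> 'k \<times> 'k \<Rightarrow> 'k" where
  "dvg P p = pd1 (\<lambda>p. fst (P p)) p + pd2 (\<lambda>p. snd (P p)) p"

text \<open>For \<open>d = (cos \<theta>, sin \<theta>)\<close> with unit normal \<open>n\<close>, a form \<open>P\<close> of degree \<open>l\<close> lies in the kernel for the cusp with
  angle \<open>\<theta>\<close> iff \<open>P(d)\<close> is parallel to \<open>d\<close> and \<open>2 \<langle>DP(d) n, n\<rangle> = 3 \<langle>P(d), d\<rangle>\<close>. Adding Euler's identity
  \<open>\<langle>DP(d) d, d\<rangle> = l \<langle>P(d), d\<rangle>\<close> turns both conditions into the single one \<open>2 div P(d) d = (2l + 3) P(d)\<close>.\<close>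

definition obstruction :: "nat \<Rightarrow> ('k::real_normed_field \<times> 'k \<Rightarrow> 'k \<times> 'k) \<Rightarrow> 'k \<times> 'k \<Rightarrow> 'k \<times> 'k" where
  "obstruction l P p = smult_pair (2 * dvg P p) p - smult_pair (of_nat (2 * l + 3)) (P p)"

lemma hom_vf_diff: "hom_vf l P \<Longrightarrow> hom_vf l Q \<Longrightarrow> hom_vf l (\<lambda>p. P p - Q p)"
  by (simp add: hom_vf_def hom_poly_diff)

lemma hom_vf_add: "hom_vf l P \<Longrightarrow> hom_vf l Q \<Longrightarrow> hom_vf l (\<lambda>p. P p + Q p)"
  by (simp add: hom_vf_def hom_poly.add)

lemma hom_vf_zero: "hom_vf l (\<lambda>p. 0)"
  by (simp add: hom_vf_def hom_poly_zero)

lemma hom_vf_sum: "(\<And>j. j \<in> J \<Longrightarrow> hom_vf l (P j)) \<Longrightarrow> hom_vf l (\<lambda>p. \<Sum>j\<in>J. P j p)"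
  by (induction J rule: infinite_finite_induct) (auto intro: hom_vf_add hom_vf_zero)

lemma hom_vf_mpow_vf: "hom_vf l P \<Longrightarrow> P \<in> mpow_vf l"
  by (simp add: hom_vf_def mpow_vf_def hom_poly_mpow)

lemma mpow_vf_diff: "\<xi> \<in> mpow_vf l \<Longrightarrow> \<zeta> \<in> mpow_vf l \<Longrightarrow> (\<lambda>p. \<xi> p - \<zeta> p) \<in> mpow_vf l"
  by (simp add: mpow_vf_def mpow_diff)

lemma mpow_vf_add: "\<xi> \<in> mpow_vf l \<Longrightarrow> \<zeta> \<in> mpow_vf l \<Longrightarrow> (\<lambda>p. \<xi> p + \<zeta> p) \<in> mpow_vf l"
  by (simp add: mpow_vf_def mpow_add)

lemma mpow_vf_sum: "(\<And>j. j \<in> J \<Longrightarrow> \<xi> j \<in> mpow_vf l) \<Longrightarrow> (\<lambda>p. \<Sum>j\<in>J. \<xi> j p) \<in> mpow_vf l"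
  by (induction J rule: infinite_finite_induct)
    (auto intro: mpow_vf_add hom_vf_mpow_vf[OF hom_vf_zero])

lemma mpow_vf_leading_form:
  assumes "\<xi> \<in> mpow_vf l"
  shows "\<exists>P. hom_vf l P \<and> (\<lambda>p. \<xi> p - P p) \<in> mpow_vf (Suc l)"
proof -
  obtain P1 P2 where "hom_poly l P1" "(\<lambda>p. fst (\<xi> p) - P1 p) \<in> mpow (Suc l)"
      "hom_poly l P2" "(\<lambda>p. snd (\<xi> p) - P2 p) \<in> mpow (Suc l)"
    using assms mpow_leading_form unfolding mpow_vf_def by blast
  then show ?thesis
    by (intro exI[of _ "\<lambda>p. (P1 p, P2 p)"]) (simp add: hom_vf_def mpow_vf_def)
qed

lemma hom_vf_mpow_vf_Suc_eq_0:
  assumes "hom_vf l P" "P \<in> mpow_vf (Suc l)"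
  shows "P p = 0"
  using assms hom_poly_mpow_Suc_eq_0[of l "\<lambda>p. fst (P p)" p] hom_poly_mpow_Suc_eq_0[of l "\<lambda>p. snd (P p)" p]
  by (simp add: hom_vf_def mpow_vf_def prod_eq_iff)

lemma dvg_add:
  assumes "hom_vf l P" "hom_vf l Q"
  shows "dvg (\<lambda>p. P p + Q p) p = dvg P p + dvg Q p"
  using assms unfolding hom_vf_def dvg_def by (simp add: pd_add[of l _ l])

lemma dvg_zero: "dvg (\<lambda>p. 0) p = 0"
  by (simp add: dvg_def pd_const)

lemma obstruction_add:
  assumes "hom_vf l P" "hom_vf l Q"
  shows "obstruction l (\<lambda>p. P p + Q p) p = obstruction l P p + obstruction l Q p"
  by (simp add: obstruction_def dvg_add[OF assms] smult_pair_def prod_eq_iff algebra_simps)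

lemma obstruction_diff:
  assumes "hom_vf l P" "hom_vf l Q"
  shows "obstruction l (\<lambda>p. P p - Q p) p = obstruction l P p - obstruction l Q p"
  using obstruction_add[OF hom_vf_diff[OF assms] assms(2), of p] by simp

lemma obstruction_zero: "obstruction l (\<lambda>p. 0) p = 0"
  by (simp add: obstruction_def dvg_zero smult_pair_def prod_eq_iff)

lemma obstruction_sum:
  "(\<And>j. j \<in> J \<Longrightarrow> hom_vf l (P j)) \<Longrightarrow> obstruction l (\<lambda>p. \<Sum>j\<in>J. P j p) p = (\<Sum>j\<in>J. obstruction l (P j) p)"
  by (induction J rule: infinite_finite_induct) (auto simp: obstruction_zero obstruction_add hom_vf_sum)

section \<open>Inverting the obstruction map\<close>

lemma hom_poly_dvg: "hom_vf (Suc l) P \<Longrightarrow> hom_poly l (dvg P)"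
  unfolding dvg_def[abs_def] hom_vf_def by (intro hom_poly.add hom_poly_pd) auto

lemma hom_vf_radial:
  assumes "hom_poly l g"
  shows "hom_vf (Suc l) (\<lambda>p. smult_pair (c * g p) p)"
  using hom_poly_linear_mult[OF assms, of c 0] hom_poly_linear_mult[OF assms, of 0 c]
  by (simp add: hom_vf_def smult_pair_def ac_simps)

lemma dvg_radial:
  assumes "hom_poly l g"
  shows "dvg (\<lambda>p. smult_pair (c * g p) p) p = c * of_nat (l + 2) * g p"
proof -
  note g = hom_poly_cmult[OF assms, of c]
  have "dvg (\<lambda>p. smult_pair (c * g p) p) p
      = 2 * (c * g p) + (fst p * pd1 (\<lambda>p. c * g p) p + snd p * pd2 (\<lambda>p. c * g p) p)"
    using pd_mult_coord(1,4)[OF g, of p] by (simp add: dvg_def smult_pair_def mult.commute[of _ "fst _"] mult.commute[of _ "snd _"] algebra_simps)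
  then show ?thesis by (simp add: euler_identity[OF g] algebra_simps)
qed

lemma hom_vf_smult:
  assumes "hom_vf l P"
  shows "hom_vf l (\<lambda>p. smult_pair c (P p))"
  using assms by (simp add: hom_vf_def smult_pair_def hom_poly_cmult)

lemma dvg_smult:
  assumes "hom_vf l P"
  shows "dvg (\<lambda>p. smult_pair c (P p)) p = c * dvg P p"
  using assms by (simp add: dvg_def hom_vf_def smult_pair_def pd_cmult[of l] algebra_simps)

lemma hom_vf_obstruction:
  assumes "hom_vf (Suc l) P"
  shows "hom_vf (Suc l) (obstruction (Suc l) P)"
  unfolding obstruction_def[abs_def]
  by (intro hom_vf_diff hom_vf_radial hom_poly_dvg hom_vf_smult assms)

text \<open>In degree l + 1 the radial term has divergence 2 (l + 2) div P and the linear term (2 (l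
  + 1) + 3) div P; the factors differ by exactly 1.\<close>

lemma dvg_obstruction:
  assumes "hom_vf (Suc l) P"
  shows "dvg (obstruction (Suc l) P) p = - dvg P p"
proof -
  have "dvg (\<lambda>p. obstruction (Suc l) P p + smult_pair (of_nat (2 * Suc l + 3)) (P p)) p
      = dvg (obstruction (Suc l) P) p + dvg (\<lambda>p. smult_pair (of_nat (2 * Suc l + 3)) (P p)) p"
    by (intro dvg_add[of "Suc l"] hom_vf_obstruction hom_vf_smult assms)
  moreover have "(\<lambda>p. obstruction (Suc l) P p + smult_pair (of_nat (2 * Suc l + 3)) (P p)) = (\<lambda>p. smult_pair (2 * dvg P p) p)"
    by (simp add: obstruction_def)
  ultimately have "2 * of_nat (l + 2) * dvg P p = dvg (obstruction (Suc l) P) p + of_nat (2 * Suc l + 3) * dvg P p"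
    by (simp only: dvg_radial[OF hom_poly_dvg[OF assms]] dvg_smult[OF assms])
  then show ?thesis by (simp add: algebra_simps eq_neg_iff_add_eq_0)
qed

lemma obstruction_inj:
  fixes P :: "'k::real_normed_field \<times> 'k \<Rightarrow> 'k \<times> 'k"
  assumes "hom_vf (Suc l) P" "\<And>p. obstruction (Suc l) P p = 0"
  shows "P p = 0"
proof -
  have "obstruction (Suc l) P = (\<lambda>p. 0)" using assms(2) by auto
  then have "dvg P p = 0" using dvg_obstruction[OF assms(1), of p] by (simp add: dvg_zero)
  moreover have "of_nat (2 * Suc l + 3) \<noteq> (0::'k)" unfolding of_nat_eq_0_iff by simp
  ultimately show ?thesis using assms(2)[of p]
    by (simp add: obstruction_def smult_pair_def prod_eq_iff del: of_nat_add of_nat_Suc of_nat_mult)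
qed

lemma obstruction_surj:
  fixes W :: "'k::real_normed_field \<times> 'k \<Rightarrow> 'k \<times> 'k"
  assumes "hom_vf (Suc l) W"
  obtains P where "hom_vf (Suc l) P" "\<And>p. obstruction (Suc l) P p = W p"
proof -
  define N :: 'k where "N = of_nat (2 * Suc l + 3)"
  have N: "N \<noteq> 0" unfolding N_def of_nat_eq_0_iff by simp
  \<comment> \<open>Since div P = - div W is forced, solving W = 2 div P p - N P for P gives P = -
    (W + 2 div W p) / N.\<close>
  define Q where "Q p = smult_pair (2 * dvg W p) p + W p" for p
  define P where "P p = smult_pair (- 1 / N) (Q p)" for p
  note rad = hom_vf_radial[OF hom_poly_dvg[OF assms], of 2]
  have Q: "hom_vf (Suc l) Q" unfolding Q_def[abs_def] by (intro hom_vf_add rad assms)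
  have "dvg Q p = N * dvg W p" for p
    unfolding Q_def[abs_def] dvg_add[OF rad assms] dvg_radial[OF hom_poly_dvg[OF assms]]
    by (simp add: N_def algebra_simps)
  then have "dvg P p = - dvg W p" for p
    unfolding P_def[abs_def] dvg_smult[OF Q] using N by simp
  then have "obstruction (Suc l) P p = W p" for p
    using N unfolding obstruction_def N_def[symmetric]
    by (simp add: P_def Q_def smult_pair_def prod_eq_iff)
  moreover have "hom_vf (Suc l) P" unfolding P_def[abs_def] by (rule hom_vf_smult[OF Q])
  ultimately show thesis using that by blast
qed

lemma hom_vf_eq_0_if_obstruction_zero:
  assumes P: "hom_vf (Suc l) P" and "\<And>k. k \<le> Suc l \<Longrightarrow> obstruction (Suc l) P (d k) = 0"
    and "\<And>j k. j \<le> Suc l \<Longrightarrow> k \<le> Suc l \<Longrightarrow> j \<noteq> k \<Longrightarrow> cross2 (d j) (d k) \<noteq> 0"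
    and "\<And>k. k \<le> Suc l \<Longrightarrow> d k \<noteq> (0, 0)"
  shows "P p = 0"
proof (rule obstruction_inj[OF P])
  fix p
  have "fst (obstruction (Suc l) P p) = 0" "snd (obstruction (Suc l) P p) = 0"
    using hom_vf_obstruction[OF P] assms(2-)
      hom_poly_eq_0_if_many_zeros[of "Suc l" "\<lambda>p. fst (obstruction (Suc l) P p)" d p]
      hom_poly_eq_0_if_many_zeros[of "Suc l" "\<lambda>p. snd (obstruction (Suc l) P p)" d p]
    by (simp_all add: hom_vf_def)
  then show "obstruction (Suc l) P p = 0" by (simp add: prod_eq_iff)
qed

text \<open>The field with a prescribed obstruction \<^term>\<open>w\<close> at \<^term>\<open>d j\<close> and none at the other directions
  comes from the product of the linear forms vanishing at those directions.\<close>

lemma obstruction_interpolation: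
  fixes d :: "nat \<Rightarrow> 'k::real_normed_field \<times> 'k"
  assumes j: "j \<le> Suc l"
    and indep: "\<And>j k. j \<le> Suc l \<Longrightarrow> k \<le> Suc l \<Longrightarrow> j \<noteq> k \<Longrightarrow> cross2 (d j) (d k) \<noteq> 0"
  obtains P where "hom_vf (Suc l) P" "obstruction (Suc l) P (d j) = w"
    "\<And>k. k \<le> Suc l \<Longrightarrow> k \<noteq> j \<Longrightarrow> obstruction (Suc l) P (d k) = 0"
proof -
  define J where "J = {0..Suc l} - {j}"
  define h where "h p = (\<Prod>k\<in>J. cross2 (d k) p)" for p
  have "hom_poly (card J) (\<lambda>p. \<Prod>k\<in>J. - snd (d k) * fst p + fst (d k) * snd p)"
    by (rule hom_poly_prod) (simp add: J_def)
  moreover have "card J = Suc l" using j by (simp add: J_def)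
  ultimately have h: "hom_poly (Suc l) h" by (simp add: h_def[abs_def] cross2_def)
  have hj: "h (d j) \<noteq> 0" using indep j by (auto simp: h_def J_def)
  have hk: "h (d k) = 0" if "k \<le> Suc l" "k \<noteq> j" for k
  proof -
    have "cross2 (d k) (d k) = 0" by (simp add: cross2_def)
    then show ?thesis using that by (auto simp: h_def J_def)
  qed
  define W where "W p = smult_pair (h p / h (d j)) w" for p
  have "hom_vf (Suc l) W"
    using hom_poly_cmult[OF h, of "fst w / h (d j)"] hom_poly_cmult[OF h, of "snd w / h (d j)"]
    by (simp add: hom_vf_def W_def smult_pair_def ac_simps)
  then obtain P where "hom_vf (Suc l) P" "\<And>p. obstruction (Suc l) P p = W p"
    using obstruction_surj by blast
  then show thesis
    using hj hk by (intro that[of P]) (auto simp: W_def smult_pair_def prod_eq_iff)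
qed

text \<open>Isolates the linear algebra from the analysis of germs. The hypotheses on
  \<open>K\<close> are asymmetric: necessity concerns arbitrary germs through their leading forms,
  while sufficiency concerns forms only, since the summands are chosen among forms.\<close>

lemma graded_direct_sum_if_obstruction:
  fixes d :: "nat \<Rightarrow> 'k::real_normed_field \<times> 'k"
  assumes i: "i = Suc l"
    and indep: "\<And>j k. j \<le> i \<Longrightarrow> k \<le> i \<Longrightarrow> j \<noteq> k \<Longrightarrow> cross2 (d j) (d k) \<noteq> 0"
    and nz: "\<And>k. k \<le> i \<Longrightarrow> d k \<noteq> (0, 0)"
    and sub: "\<And>j. j \<le> i \<Longrightarrow> K j \<subseteq> mpow_vf i"
    and nec: "\<And>j k \<xi> P. \<xi> \<in> K j \<Longrightarrow> hom_vf i P \<Longrightarrow> (\<lambda>p. \<xi> p - P p) \<in> mpow_vf (Suc i) \<Longrightarrow>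
        j \<le> i \<Longrightarrow> k \<le> i \<Longrightarrow> k \<noteq> j \<Longrightarrow> obstruction i P (d k) = 0"
    and suff: "\<And>j P. hom_vf i P \<Longrightarrow> j \<le> i \<Longrightarrow> (\<And>k. k \<le> i \<Longrightarrow> k \<noteq> j \<Longrightarrow> obstruction i P (d k) = 0) \<Longrightarrow> P \<in> K j"
  shows "graded_direct_sum i K {0..i}"
  unfolding graded_direct_sum_def
proof (intro conjI ballI allI impI)
  fix j assume "j \<in> {0..i}"
  then show "K j \<subseteq> mpow_vf i" using sub by simp
next
  fix \<xi> :: "'k \<times> 'k \<Rightarrow> 'k \<times> 'k" assume "\<xi> \<in> mpow_vf i"
  then obtain P where P: "hom_vf i P" "(\<lambda>p. \<xi> p - P p) \<in> mpow_vf (Suc i)"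
    using mpow_vf_leading_form by blast
  have "\<forall>j\<in>{0..i}. \<exists>Q. hom_vf i Q \<and> obstruction i Q (d j) = obstruction i P (d j) \<and>
      (\<forall>k\<le>i. k \<noteq> j \<longrightarrow> obstruction i Q (d k) = 0)"
  proof
    fix j assume "j \<in> {0..i}"
    then have "j \<le> Suc l" using i by simp
    then obtain Q where "hom_vf (Suc l) Q" "obstruction (Suc l) Q (d j) = obstruction i P (d j)"
      "\<And>k. k \<le> Suc l \<Longrightarrow> k \<noteq> j \<Longrightarrow> obstruction (Suc l) Q (d k) = 0"
      by (rule obstruction_interpolation[of j l d "obstruction i P (d j)"]) (use indep i in auto)
    then show "\<exists>Q. hom_vf i Q \<and> obstruction i Q (d j) = obstruction i P (d j) \<and>
      (\<forall>k\<le>i. k \<noteq> j \<longrightarrow> obstruction i Q (d k) = 0)" using i by blast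
  qed
  then obtain Q where Q: "\<And>j. j \<in> {0..i} \<Longrightarrow> hom_vf i (Q j)"
      "\<And>j. j \<in> {0..i} \<Longrightarrow> obstruction i (Q j) (d j) = obstruction i P (d j)"
      "\<And>j k. j \<in> {0..i} \<Longrightarrow> k \<le> i \<Longrightarrow> k \<noteq> j \<Longrightarrow> obstruction i (Q j) (d k) = 0"
    by metis
  have hQ: "hom_vf i (\<lambda>p. \<Sum>j\<in>{0..i}. Q j p)" using Q(1) by (rule hom_vf_sum)
  \<comment> \<open>At \<open>d k\<close> only the summand with index k has a nonzero obstruction,
    and it is that of P; so the difference has none at any of the i + 1 directions.\<close>
  have "P p - (\<Sum>j\<in>{0..i}. Q j p) = 0" for p
  proof (rule hom_vf_eq_0_if_obstruction_zero[of l "\<lambda>p. P p - (\<Sum>j\<in>{0..i}. Q j p)" d])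
    show "hom_vf (Suc l) (\<lambda>p. P p - (\<Sum>j\<in>{0..i}. Q j p))"
      using hom_vf_diff[OF P(1) hQ] i by simp
    fix k assume k: "k \<le> Suc l"
    have "(\<Sum>j\<in>{0..i}. obstruction i (Q j) (d k)) = (\<Sum>j\<in>{0..i}. if j = k then obstruction i P (d k) else 0)"
      using Q k i by (intro sum.cong) auto
    also have "\<dots> = obstruction i P (d k)" using k i by simp
    finally show "obstruction (Suc l) (\<lambda>p. P p - (\<Sum>j\<in>{0..i}. Q j p)) (d k) = 0"
      using obstruction_diff[OF P(1) hQ, of "d k"] obstruction_sum[of "{0..i}" i Q "d k"] Q(1) i by simp
  qed (use indep nz i in auto)
  then have "(\<Sum>j\<in>{0..i}. Q j p) = P p" for p by simp
  then have "(\<lambda>p. \<xi> p - (\<Sum>j\<in>{0..i}. Q j p)) \<in> mpow_vf (Suc i)" using P(2) by simp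
  moreover have "\<forall>j\<in>{0..i}. Q j \<in> K j" using Q suff by simp
  ultimately show "\<exists>\<xi>s. (\<forall>j\<in>{0..i}. \<xi>s j \<in> K j) \<and> (\<lambda>p. \<xi> p - (\<Sum>j\<in>{0..i}. \<xi>s j p)) \<in> mpow_vf (Suc i)"
    by blast
next
  fix \<xi>s j
  assume \<xi>s: "(\<forall>j\<in>{0..i}. \<xi>s j \<in> K j) \<and> (\<lambda>p. \<Sum>j\<in>{0..i}. \<xi>s j p) \<in> mpow_vf (Suc i)" and j: "j \<in> {0..i}"
  have "\<forall>j\<in>{0..i}. \<exists>P. hom_vf i P \<and> (\<lambda>p. \<xi>s j p - P p) \<in> mpow_vf (Suc i)"
    using \<xi>s sub mpow_vf_leading_form by fastforce
  then obtain P where P: "\<And>j. j \<in> {0..i} \<Longrightarrow> hom_vf i (P j)"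
      "\<And>j. j \<in> {0..i} \<Longrightarrow> (\<lambda>p. \<xi>s j p - P j p) \<in> mpow_vf (Suc i)"
    by metis
  have off: "obstruction i (P j) (d k) = 0" if "j \<in> {0..i}" "k \<le> i" "k \<noteq> j" for j k
    using nec[of "\<xi>s j" j "P j" k] P[OF that(1)] \<xi>s that by simp
  \<comment> \<open>Passing to leading forms changes the sum only by higher order terms, so the sum
    of the leading forms is a form of degree i in \<open>mpow_vf (Suc i)\<close>, hence
    zero.\<close>
  have "(\<lambda>p. (\<Sum>j\<in>{0..i}. \<xi>s j p) - (\<Sum>j\<in>{0..i}. \<xi>s j p - P j p)) \<in> mpow_vf (Suc i)"
    using \<xi>s mpow_vf_sum[of "{0..i}" "\<lambda>j p. \<xi>s j p - P j p", OF P(2)] by (intro mpow_vf_diff) simp_all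
  then have "(\<lambda>p. \<Sum>j\<in>{0..i}. P j p) \<in> mpow_vf (Suc i)" by (simp add: sum_subtractf)
  then have "(\<lambda>p. \<Sum>j\<in>{0..i}. P j p) = (\<lambda>p. 0)"
    using hom_vf_mpow_vf_Suc_eq_0[OF hom_vf_sum[of "{0..i}" i P]] P(1) by auto
  then have "(\<Sum>k\<in>{0..i}. obstruction i (P k) (d j)) = 0"
    using obstruction_sum[of "{0..i}" i P "d j"] P(1) by (simp add: obstruction_zero)
  \<comment> \<open>At \<open>d j\<close> the other summands have no obstruction, so the vanishing
    of the sum supplies the one condition on \<open>P j\<close> that membership in
    \<open>K j\<close> does not give.\<close>
  moreover have "(\<Sum>k\<in>{0..i}. obstruction i (P k) (d j)) = (\<Sum>k\<in>{0..i}. if k = j then obstruction i (P j) (d j) else 0)"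
    using off j by (intro sum.cong) auto
  ultimately have "obstruction i (P j) (d j) = 0" using j by simp
  then have "obstruction i (P j) (d k) = 0" if "k \<le> i" for k using off that j by (cases "k = j") auto
  then have "P j p = 0" for p
    using hom_vf_eq_0_if_obstruction_zero[of l "P j" d p] P(1)[OF j] indep nz i by simp
  then show "\<xi>s j \<in> mpow_vf (Suc i)" using P(2)[OF j] by simp
qed

section \<open>Germs along a multicusp\<close>

lemma open_eventually_nhds: "open {y. eventually P (nhds y)}"
proof (subst open_subopen, safe)
  fix y assume "eventually P (nhds y)"
  then have "eventually (\<lambda>x. eventually P (nhds x)) (nhds y)" by (simp add: eventually_eventually)
  then show "\<exists>T. open T \<and> y \<in> T \<and> T \<subseteq> {y. eventually P (nhds y)}"
    unfolding eventually_nhds[of _ y] by blast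
qed

text \<open>The set of points near which two functions agree is open and serves as a common
  neighbourhood of S. Identities of multigerms thus reduce to single branches.\<close>

lemma germ_eq_iff: "germ_eq S a b \<longleftrightarrow> (\<forall>s\<in>S. \<forall>\<^sub>F x in nhds s. a x = b x)"
proof
  assume "\<forall>s\<in>S. \<forall>\<^sub>F x in nhds s. a x = b x"
  then show "germ_eq S a b"
    unfolding germ_eq_def
    by (intro exI[of _ "{y. \<forall>\<^sub>F x in nhds y. a x = b x}"])
      (auto simp: open_eventually_nhds dest: eventually_nhds_x_imp_x)
qed (auto simp: germ_eq_def eventually_nhds)

lemma smooth1_on_poly: "smooth1_on UNIV (\<lambda>x. poly q (x - c))"
proof -
  have d: "((\<lambda>x. poly q (x - c)) has_field_derivative poly (pderiv q) (x - c)) (at x)" for q x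
    by (rule DERIV_cong[OF DERIV_chain2[OF poly_DERIV]]) (auto intro!: derivative_eq_intros)
  have "(deriv ^^ n) (\<lambda>x. poly q (x - c)) = (\<lambda>x. poly ((pderiv ^^ n) q) (x - c))" for n
    by (induction n) (simp_all add: DERIV_imp_deriv[OF d])
  then show ?thesis unfolding smooth1_on_def using d by (simp add: DERIV_imp_deriv[OF d])
qed

lemma smooth1_on_cong:
  assumes "smooth1_on V g" "open U" "U \<subseteq> V" "\<And>x. x \<in> U \<Longrightarrow> h x = g x"
  shows "smooth1_on U h"
proof -
  have eq: "(deriv ^^ n) h x = (deriv ^^ n) g x" if "x \<in> U" for n x
    using that
  proof (induction n arbitrary: x)
    case (Suc n)
    then have "\<forall>\<^sub>F y in nhds x. (deriv ^^ n) h y = (deriv ^^ n) g y"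
      using assms(2) by (auto simp: eventually_nhds)
    then show ?case by (simp add: deriv_cong_ev)
  qed (simp add: assms)
  show ?thesis
    unfolding smooth1_on_def
  proof (intro conjI allI ballI)
    fix n x assume x: "x \<in> U"
    have "((deriv ^^ n) g has_field_derivative (deriv ^^ Suc n) g x) (at x)"
      using assms(1,3) x unfolding smooth1_on_def by blast
    then show "((deriv ^^ n) h has_field_derivative (deriv ^^ Suc n) h x) (at x)"
      unfolding eq[OF x]
      by (rule has_field_derivative_transform_within_open[OF _ assms(2) x]) (simp add: eq)
  qed (fact assms(2))
qed

lemma germS_if_locally_poly:
  assumes "\<And>s. s \<in> S \<Longrightarrow> \<exists>q c. \<forall>\<^sub>F x in nhds s. h x = poly q (x - c)"
  shows "germS S h"
proof -
  have "\<exists>U. s \<in> U \<and> smooth1_on U h" if s: "s \<in> S" for s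
  proof -
    obtain q c U where U: "open U" "s \<in> U" "\<And>x. x \<in> U \<Longrightarrow> h x = poly q (x - c)"
      using assms[OF s] by (auto simp: eventually_nhds)
    then show ?thesis using smooth1_on_cong[OF smooth1_on_poly U(1) _ U(3)] by blast
  qed
  then obtain U where U: "\<And>s. s \<in> S \<Longrightarrow> s \<in> U s \<and> smooth1_on (U s) h" by metis
  then have "smooth1_on (\<Union>s\<in>S. U s) h" unfolding smooth1_on_def by blast
  then show ?thesis unfolding germS_def using U by blast
qed

text \<open>The index of the nearest point, which is constant near each of them. It allows one
  function to be prescribed independently on every branch; where no nearest point is unique its
  value is irrelevant.\<close>

lemma index_near_finite_points:
  fixes s :: "nat \<Rightarrow> 'a::metric_space"
  assumes "finite J" "inj_on s J"
  obtains \<kappa> where "\<And>k. k \<in> J \<Longrightarrow> \<forall>\<^sub>F x in nhds (s k). \<kappa> x = k"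
proof -
  define near where "near x k \<longleftrightarrow> k \<in> J \<and> (\<forall>m\<in>J. m \<noteq> k \<longrightarrow> dist x (s k) < dist x (s m))" for x k
  have "\<forall>\<^sub>F x in nhds (s k). (THE k. near x k) = k" if k: "k \<in> J" for k
  proof -
    have "\<forall>\<^sub>F x in nhds (s k). dist x (s k) < dist x (s m)" if m: "m \<in> J - {k}" for m
    proof -
      have "s m \<noteq> s k" using assms(2) k m by (auto dest: inj_onD)
      moreover have "open {x. dist x (s k) < dist x (s m)}"
        by (intro open_Collect_less continuous_intros)
      ultimately show ?thesis by (auto simp: eventually_nhds intro!: exI[of _ "{x. dist x (s k) < dist x (s m)}"])
    qed
    then have "\<forall>\<^sub>F x in nhds (s k). \<forall>m\<in>J - {k}. dist x (s k) < dist x (s m)"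
      using assms(1) by (intro eventually_ball_finite) auto
    then show ?thesis
    proof eventually_elim
      case (elim x)
      then have nk: "near x k" using k by (auto simp: near_def)
      show ?case
      proof (rule the_equality[of "near x", OF nk])
        fix m assume "near x m"
        with nk show "m = k" unfolding near_def using less_asym by blast
      qed
    qed
  qed
  then show thesis by (rule that)
qed

section \<open>One cusp branch in its local parameter\<close>

definition dir :: "real \<Rightarrow> 'k::real_normed_field \<times> 'k" where
  "dir \<theta> = (of_real (cos \<theta>), of_real (sin \<theta>))"

lemma dir_norm: "(of_real (cos \<theta>))\<^sup>2 + (of_real (sin \<theta>))\<^sup>2 = (1::'k::real_normed_field)"
  by (simp flip: of_real_power of_real_add)

lemma cusp_branch_eq:
  "cusp_branch \<theta> s x = ((x - s)\<^sup>2 * (of_real (cos \<theta>) + (x - s) * - of_real (sin \<theta>)),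
     (x - s)\<^sup>2 * (of_real (sin \<theta>) + (x - s) * of_real (cos \<theta>)))"
  by (simp add: cusp_branch_def rot_def cusp_def power2_eq_square power3_eq_cube algebra_simps)

lemma deriv_cusp_branch:
  "deriv (\<lambda>x. fst (cusp_branch \<theta> s x)) x = (x - s) * (2 * of_real (cos \<theta>) - 3 * of_real (sin \<theta>) * (x - s))"
  "deriv (\<lambda>x. snd (cusp_branch \<theta> s x)) x = (x - s) * (2 * of_real (sin \<theta>) + 3 * of_real (cos \<theta>) * (x - s))"
  unfolding cusp_branch_eq fst_conv snd_conv
  by (rule DERIV_imp_deriv; auto intro!: derivative_eq_intros simp: power2_eq_square algebra_simps)+

lemma tf_cusp_branch:
  fixes f :: "'k::real_normed_field \<Rightarrow> 'k \<times> 'k"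
  assumes "\<forall>\<^sub>F x in nhds s. f x = cusp_branch \<theta> s x"
  shows "\<forall>\<^sub>F x in nhds s. tf f \<eta> x =
    ((x - s) * (2 * of_real (cos \<theta>) - 3 * of_real (sin \<theta>) * (x - s)) * \<eta> x,
     (x - s) * (2 * of_real (sin \<theta>) + 3 * of_real (cos \<theta>) * (x - s)) * \<eta> x)"
proof -
  \<comment> \<open>The derivative at a nearby x depends on f around x, so agreement is needed near
    every such x and not only at it.\<close>
  have "\<forall>\<^sub>F x in nhds s. \<forall>\<^sub>F y in nhds x. f y = cusp_branch \<theta> s y"
    using assms by (simp add: eventually_eventually)
  then show ?thesis
  proof eventually_elim
    case (elim x)
    have "deriv (\<lambda>x. fst (f x)) x = deriv (\<lambda>x. fst (cusp_branch \<theta> s x)) x"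
      "deriv (\<lambda>x. snd (f x)) x = deriv (\<lambda>x. snd (cusp_branch \<theta> s x)) x"
      by (intro deriv_cong_ev refl eventually_mono[OF elim]; simp)+
    then show ?case by (simp add: tf_def deriv_cusp_branch)
  qed
qed

lemma hom_poly_cusp_branch:
  assumes "hom_poly l g"
  shows "g (cusp_branch \<theta> s x) = (x - s) ^ (2 * l) *
    g (of_real (cos \<theta>) + (x - s) * - of_real (sin \<theta>), of_real (sin \<theta>) + (x - s) * of_real (cos \<theta>))"
  unfolding cusp_branch_eq hom_poly_scale[OF assms] by (simp add: power_mult)

text \<open>The branch itself has order 2 in the local parameter, so the growth estimate of degree l
  for u doubles to order 2l.\<close>

lemma mpow_comp_cusp_bigo:
  fixes u :: "'k::real_normed_field \<times> 'k \<Rightarrow> 'k"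
  assumes u: "u \<in> mpow l" and f: "\<forall>\<^sub>F x in nhds s. f x = cusp_branch \<theta> s x"
  shows "(\<lambda>x. u (f x)) \<in> O[nhds s](\<lambda>x. (x - s) ^ (2 * l))"
proof -
  obtain C r where C: "r > 0" "C \<ge> 0"
    "\<And>x y. norm x < r \<Longrightarrow> norm y < r \<Longrightarrow> norm (u (x, y)) \<le> C * (norm x + norm y) ^ l"
    using mpow_bound[OF u] by blast
  define g1 g2 :: "'k \<Rightarrow> 'k" where "g1 x = of_real (cos \<theta>) + (x - s) * - of_real (sin \<theta>)"
    and "g2 x = of_real (sin \<theta>) + (x - s) * of_real (cos \<theta>)" for x
  have "((\<lambda>x. norm ((x - s)\<^sup>2 * g1 x)) \<longlongrightarrow> norm ((s - s)\<^sup>2 * g1 s)) (nhds s)"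
    "((\<lambda>x. norm ((x - s)\<^sup>2 * g2 x)) \<longlongrightarrow> norm ((s - s)\<^sup>2 * g2 s)) (nhds s)"
    "((\<lambda>x. norm (g1 x) + norm (g2 x)) \<longlongrightarrow> norm (g1 s) + norm (g2 s)) (nhds s)"
    unfolding g1_def g2_def by (intro tendsto_intros filterlim_ident)+
  then have "\<forall>\<^sub>F x in nhds s. norm ((x - s)\<^sup>2 * g1 x) < r" "\<forall>\<^sub>F x in nhds s. norm ((x - s)\<^sup>2 * g2 x) < r"
    "\<forall>\<^sub>F x in nhds s. norm (g1 x) + norm (g2 x) < norm (g1 s) + norm (g2 s) + 1"
    using C(1) by (auto intro!: order_tendstoD)
  then have "\<forall>\<^sub>F x in nhds s. norm (u (f x)) \<le> (C * (norm (g1 s) + norm (g2 s) + 1) ^ l) * norm ((x - s) ^ (2 * l))"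
    using f
  proof eventually_elim
    case (elim x)
    have "norm (u (f x)) \<le> C * (norm ((x - s)\<^sup>2 * g1 x) + norm ((x - s)\<^sup>2 * g2 x)) ^ l"
      using C(3)[OF elim(1,2)] elim(4) by (simp add: cusp_branch_eq g1_def g2_def)
    also have "norm ((x - s)\<^sup>2 * g1 x) + norm ((x - s)\<^sup>2 * g2 x) = (norm (g1 x) + norm (g2 x)) * norm (x - s) ^ 2"
      by (simp add: norm_mult norm_power algebra_simps)
    also have "C * ((norm (g1 x) + norm (g2 x)) * norm (x - s) ^ 2) ^ l
        \<le> C * ((norm (g1 s) + norm (g2 s) + 1) * norm (x - s) ^ 2) ^ l"
      using elim(3) C(2) by (intro mult_left_mono power_mono mult_right_mono) auto
    finally show ?case by (simp add: power_mult_distrib norm_power power_mult)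
  qed
  then show ?thesis by (rule bigoI)
qed

lemma germS_bounded:
  fixes v :: "'k::real_normed_field \<Rightarrow> 'k"
  assumes "germS S v" "s \<in> S"
  shows "v \<in> O[nhds s](\<lambda>_. 1)"
proof -
  obtain U where U: "S \<subseteq> U" "smooth1_on U v" using assms(1) unfolding germS_def by blast
  have "((deriv ^^ 0) v has_field_derivative (deriv ^^ Suc 0) v s) (at s)"
    using U assms(2) unfolding smooth1_on_def by blast
  then have "isCont v s" by (auto intro: DERIV_isCont)
  then have "(v \<longlongrightarrow> v s) (nhds s)" by (simp add: continuous_at tendsto_at_iff_tendsto_nhds)
  then have "\<forall>\<^sub>F x in nhds s. norm (v x) < norm (v s) + 1"
    by (intro order_tendstoD(2)[OF tendsto_norm]) auto
  then show ?thesis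
    by (intro bigoI[of _ "norm (v s) + 1"]) (auto elim!: eventually_mono)
qed

text \<open>The submodule enters the necessity argument through this order of vanishing: each
  generator has order 2l and its coefficient field is bounded.\<close>

lemma pullback_mod_bigo:
  fixes f :: "'k::real_normed_field \<Rightarrow> 'k \<times> 'k"
  assumes "b \<in> pullback_mod l S f" "s \<in> S" and f: "\<forall>\<^sub>F x in nhds s. f x = cusp_branch \<theta> s x"
  shows "(\<lambda>x. fst (b x)) \<in> O[nhds s](\<lambda>x. (x - s) ^ (2 * l))" "(\<lambda>x. snd (b x)) \<in> O[nhds s](\<lambda>x. (x - s) ^ (2 * l))"
proof -
  obtain N u v where uv: "\<And>k. k < (N::nat) \<Longrightarrow> u k \<in> mpow l \<and> germS_vf S (v k)"
    and eq: "\<forall>\<^sub>F x in nhds s. b x = (\<Sum>k<N. smult_pair (u k (f x)) (v k x))"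
    using assms(1,2) unfolding pullback_mod_def germ_eq_iff by blast
  have u: "(\<lambda>x. u k (f x)) \<in> O[nhds s](\<lambda>x. (x - s) ^ (2 * l))" if "k < N" for k
    using mpow_comp_cusp_bigo uv that f by blast
  have v: "(\<lambda>x. fst (v k x)) \<in> O[nhds s](\<lambda>_. 1)" "(\<lambda>x. snd (v k x)) \<in> O[nhds s](\<lambda>_. 1)" if "k < N" for k
    using germS_bounded uv that assms(2) unfolding germS_vf_def by blast+
  have "(\<lambda>x. \<Sum>k<N. u k (f x) * fst (v k x)) \<in> O[nhds s](\<lambda>x. (x - s) ^ (2 * l))"
      "(\<lambda>x. \<Sum>k<N. u k (f x) * snd (v k x)) \<in> O[nhds s](\<lambda>x. (x - s) ^ (2 * l))"
    using landau_o.big.mult[OF u v(1)] landau_o.big.mult[OF u v(2)] by (intro big_sum_in_bigo; simp)+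
  moreover have "\<forall>\<^sub>F x in nhds s. fst (b x) = (\<Sum>k<N. u k (f x) * fst (v k x))"
      "\<forall>\<^sub>F x in nhds s. snd (b x) = (\<Sum>k<N. u k (f x) * snd (v k x))"
    using eq by (auto elim!: eventually_mono simp: fst_sum snd_sum smult_pair_def)
  ultimately show "(\<lambda>x. fst (b x)) \<in> O[nhds s](\<lambda>x. (x - s) ^ (2 * l))" "(\<lambda>x. snd (b x)) \<in> O[nhds s](\<lambda>x. (x - s) ^ (2 * l))"
    by (simp_all add: landau_o.big.in_cong)
qed

lemma poly_coeff_0_if_small:
  fixes q :: "'k::real_normed_field poly"
  assumes "r > 0" "\<And>t. 0 < t \<Longrightarrow> t < r \<Longrightarrow> norm (poly q (of_real t)) \<le> C * t"
  shows "coeff q 0 = 0"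
proof -
  have "isCont (\<lambda>t. norm (poly q (of_real t))) 0" by (intro continuous_intros isCont_o2[OF _ poly_isCont])
  then have "((\<lambda>t. norm (poly q (of_real t))) \<longlongrightarrow> norm (poly q (of_real 0))) (at 0)"
    by (simp only: isCont_def)
  then have "((\<lambda>t. norm (poly q (of_real t))) \<longlongrightarrow> norm (poly q 0)) (at_right 0)"
    using tendsto_within_subset by fastforce
  moreover have "((\<lambda>t. C * t) \<longlongrightarrow> C * 0) (at_right (0::real))" by (intro tendsto_intros)
  moreover have "\<forall>\<^sub>F t in at_right (0::real). norm (poly q (of_real t)) \<le> C * t"
    using assms eventually_at_right[OF assms(1)] by blast
  ultimately have "norm (poly q 0) \<le> C * 0" by (intro tendsto_le[of "at_right (0::real)"]) auto
  then show ?thesis by (simp add: poly_0_coeff_0)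
qed

text \<open>The factor t^n cancels only away from t = 0, so the coefficients are read off along
  small positive reals, which embed in either field.\<close>

lemma poly_low_coeffs_if_bigo:
  fixes q :: "'k::real_normed_field poly"
  assumes "(\<lambda>x. (x - s) ^ n * poly q (x - s)) \<in> O[nhds s](\<lambda>x. (x - s) ^ (n + 2))"
  shows "coeff q 0 = 0" "coeff q 1 = 0"
proof -
  obtain C where C: "C > 0" "\<forall>\<^sub>F x in nhds s. norm ((x - s) ^ n * poly q (x - s)) \<le> C * norm ((x - s) ^ (n + 2))"
    using assms by (elim landau_o.bigE)
  then obtain r where r: "r > 0" "\<And>x. dist x s < r \<Longrightarrow> norm ((x - s) ^ n * poly q (x - s)) \<le> C * norm ((x - s) ^ (n + 2))"
    by (auto simp: eventually_nhds_metric)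
  have bnd: "norm (poly q (of_real t)) \<le> C * t\<^sup>2" if "0 < t" "t < r" for t
  proof -
    have "t ^ n * norm (poly q (of_real t)) \<le> t ^ n * (C * t\<^sup>2)"
      using r(2)[of "s + of_real t"] that by (simp add: dist_norm norm_mult norm_power power_add power2_eq_square ac_simps)
    then show ?thesis using that by simp
  qed
  obtain a q' where q: "q = pCons a q'" by (cases q)
  \<comment> \<open>The quadratic bound is weakened to a linear one for the constant coefficient;
    afterwards one factor t is divided out and the same criterion gives the next
    coefficient.\<close>
  have "norm (poly q (of_real t)) \<le> (C * r) * t" if "0 < t" "t < r" for t
  proof -
    have "C * t\<^sup>2 \<le> (C * r) * t" using that C(1) by (simp add: power2_eq_square)
    then show ?thesis using bnd[OF that] by linarith
  qed
  from poly_coeff_0_if_small[OF r(1) this] show c0: "coeff q 0 = 0" .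
  have "norm (poly q' (of_real t)) \<le> C * t" if "0 < t" "t < r" for t
  proof -
    have "t * norm (poly q' (of_real t)) \<le> t * (C * t)"
      using bnd[OF that] c0 that by (simp add: q norm_mult power2_eq_square ac_simps)
    then show ?thesis using that by simp
  qed
  from poly_coeff_0_if_small[OF r(1) this] show "coeff q 1 = 0" by (simp add: q)
qed

section \<open>Kernels of the graded maps\<close>

text \<open>With d = (c, s), value p and partial derivatives A and B of the components, this
  computes the trace of DP in the orthonormal frame d, n; Euler's identity \<open>e\<close> supplies
  the entry along d. It is stated for bare field elements so that polynomial algebra decides
  it.\<close>

lemma branch_condition_iff:
  fixes c s :: "'k::field"
  assumes cs: "c\<^sup>2 + s\<^sup>2 = 1" and e: "c * A1 + s * B1 = m * p1" "c * A2 + s * B2 = m * p2" and N: "2 * m + 3 \<noteq> 0"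
  shows "2 * (A1 + B2) * c - (2 * m + 3) * p1 = 0 \<and> 2 * (A1 + B2) * s - (2 * m + 3) * p2 = 0 \<longleftrightarrow>
    c * p2 - s * p1 = 0 \<and> 2 * (c * (- s * A2 + c * B2) - s * (- s * A1 + c * B1)) = 3 * (c * p1 + s * p2)"
proof -
  have key: "2 * (c * (- s * A2 + c * B2) - s * (- s * A1 + c * B1)) - 3 * (c * p1 + s * p2)
      = 2 * (A1 + B2) - (2 * m + 3) * (c * p1 + s * p2)"
    using cs e by algebra
  have "c * p2 - s * p1 = 0" if "2 * (A1 + B2) * c - (2 * m + 3) * p1 = 0" "2 * (A1 + B2) * s - (2 * m + 3) * p2 = 0"
  proof -
    \<comment> \<open>Taking the determinant with d cancels the radial term.\<close>
    have "(2 * m + 3) * (c * p2 - s * p1) = 0" using that by algebra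
    then show ?thesis using N by simp
  qed
  moreover have "2 * (A1 + B2) - (2 * m + 3) * (c * p1 + s * p2) = 0"
    if "2 * (A1 + B2) * c - (2 * m + 3) * p1 = 0" "2 * (A1 + B2) * s - (2 * m + 3) * p2 = 0"
    using that cs by algebra
  moreover have "2 * (A1 + B2) * c - (2 * m + 3) * p1 = 0 \<and> 2 * (A1 + B2) * s - (2 * m + 3) * p2 = 0"
    if "c * p2 - s * p1 = 0" "2 * (A1 + B2) - (2 * m + 3) * (c * p1 + s * p2) = 0"
  proof
    show "2 * (A1 + B2) * c - (2 * m + 3) * p1 = 0" using that cs by algebra
    show "2 * (A1 + B2) * s - (2 * m + 3) * p2 = 0" using that cs by algebra
  qed
  ultimately show ?thesis using key by (metis (no_types, lifting) diff_0_right eq_iff_diff_eq_0)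
qed

lemma obstruction_dir_iff:
  fixes P :: "'k::real_normed_field \<times> 'k \<Rightarrow> 'k \<times> 'k" and \<theta> :: real
  assumes "hom_vf l P"
  defines "c \<equiv> of_real (cos \<theta>)" and "s \<equiv> of_real (sin \<theta>)"
  shows "obstruction l P (dir \<theta>) = 0 \<longleftrightarrow> c * snd (P (c, s)) - s * fst (P (c, s)) = 0 \<and>
    2 * (c * (- s * pd1 (\<lambda>p. snd (P p)) (c, s) + c * pd2 (\<lambda>p. snd (P p)) (c, s))
       - s * (- s * pd1 (\<lambda>p. fst (P p)) (c, s) + c * pd2 (\<lambda>p. fst (P p)) (c, s)))
      = 3 * (c * fst (P (c, s)) + s * snd (P (c, s)))"
proof -
  have "of_nat (2 * l + 3) \<noteq> (0::'k)" unfolding of_nat_eq_0_iff by simp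
  then have N: "2 * of_nat l + 3 \<noteq> (0::'k)" by simp
  have e: "c * pd1 (\<lambda>p. fst (P p)) (c, s) + s * pd2 (\<lambda>p. fst (P p)) (c, s) = of_nat l * fst (P (c, s))"
      "c * pd1 (\<lambda>p. snd (P p)) (c, s) + s * pd2 (\<lambda>p. snd (P p)) (c, s) = of_nat l * snd (P (c, s))"
    using euler_identity[of l _ "(c, s)"] assms(1) by (simp_all add: hom_vf_def)
  have obs: "obstruction l P (dir \<theta>) = 0 \<longleftrightarrow>
      2 * (pd1 (\<lambda>p. fst (P p)) (c, s) + pd2 (\<lambda>p. snd (P p)) (c, s)) * c - (2 * of_nat l + 3) * fst (P (c, s)) = 0 \<and>
      2 * (pd1 (\<lambda>p. fst (P p)) (c, s) + pd2 (\<lambda>p. snd (P p)) (c, s)) * s - (2 * of_nat l + 3) * snd (P (c, s)) = 0"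
    by (simp add: obstruction_def dvg_def dir_def smult_pair_def prod_eq_iff c_def s_def)
  have "c\<^sup>2 + s\<^sup>2 = 1" unfolding c_def s_def by (rule dir_norm)
  then show ?thesis unfolding obs by (rule branch_condition_iff[OF _ e N])
qed

text \<open>Pairing with the normal of \<open>f\<close> removes the unknown field \<open>\<eta>\<close> from \<open>\<omega>f(\<xi>) = tf(\<eta>) + b\<close>; what remains
  is a polynomial in the local parameter whose two lowest coefficients are the obstruction.\<close>

lemma ker_omega_bar_imp_obstruction_zero:
  fixes f :: "'k::real_normed_field \<Rightarrow> 'k \<times> 'k"
  assumes \<xi>: "\<xi> \<in> ker_omega_bar l S f" and s0: "s0 \<in> S" and f: "\<forall>\<^sub>F x in nhds s0. f x = cusp_branch \<theta> s0 x"
    and P: "hom_vf l P" "(\<lambda>p. \<xi> p - P p) \<in> mpow_vf (Suc l)"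
  shows "obstruction l P (dir \<theta>) = 0"
proof -
  define c s :: 'k where "c = of_real (cos \<theta>)" and "s = of_real (sin \<theta>)"
  obtain a b \<eta> where b: "b \<in> pullback_mod (Suc l) S f"
    and ab: "\<forall>\<^sub>F x in nhds s0. \<xi> (f x) = a x + b x" and a: "\<forall>\<^sub>F x in nhds s0. a x = tf f \<eta> x"
    using \<xi> s0 unfolding ker_omega_bar_def TRe_def germ_eq_iff by blast
  obtain q1 where q1: "coeff q1 0 = fst (P (c, s))"
    "coeff q1 1 = - s * pd1 (\<lambda>p. fst (P p)) (c, s) + c * pd2 (\<lambda>p. fst (P p)) (c, s)"
    "\<And>t. poly q1 t = fst (P (c + t * - s, s + t * c))"
    using P(1) hom_poly_on_line[of l "\<lambda>p. fst (P p)" "- s" c c s] unfolding hom_vf_def by metis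
  obtain q2 where q2: "coeff q2 0 = snd (P (c, s))"
    "coeff q2 1 = - s * pd1 (\<lambda>p. snd (P p)) (c, s) + c * pd2 (\<lambda>p. snd (P p)) (c, s)"
    "\<And>t. poly q2 t = snd (P (c + t * - s, s + t * c))"
    using P(1) hom_poly_on_line[of l "\<lambda>p. snd (P p)" "- s" c c s] unfolding hom_vf_def by metis
  \<comment> \<open>The determinant of 2 d + 3 t n, the derivative of the branch divided by t, with
    P(d + t n). Every \<open>tf f \<eta>\<close> is a multiple of the first vector and drops
    out.\<close>
  define Q where "Q = [:2 * c, - 3 * s:] * q2 - [:2 * s, 3 * c:] * q1"
  define w1 w2 where "w1 x = 2 * c - 3 * s * (x - s0)" and "w2 x = 2 * s + 3 * c * (x - s0)" for x
  have Pf: "fst (P (cusp_branch \<theta> s0 x)) = (x - s0) ^ (2 * l) * poly q1 (x - s0)"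
      "snd (P (cusp_branch \<theta> s0 x)) = (x - s0) ^ (2 * l) * poly q2 (x - s0)" for x
    using P(1) hom_poly_cusp_branch[of l "\<lambda>p. fst (P p)" \<theta> s0 x] hom_poly_cusp_branch[of l "\<lambda>p. snd (P p)" \<theta> s0 x]
    by (simp_all add: hom_vf_def q1(3) q2(3) c_def s_def)
  have eq: "\<forall>\<^sub>F x in nhds s0. (x - s0) ^ (2 * l) * poly Q (x - s0)
      = w1 x * (snd (b x) - snd (\<xi> (f x) - P (f x))) - w2 x * (fst (b x) - fst (\<xi> (f x) - P (f x)))"
    using ab a f tf_cusp_branch[OF f, of \<eta>]
  proof eventually_elim
    case (elim x)
    have wa: "w1 x * snd (a x) - w2 x * fst (a x) = 0"
      unfolding elim(2) elim(4) by (simp add: w1_def w2_def c_def s_def)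
    have diffs: "snd (b x) - snd (\<xi> (f x) - P (f x)) = snd (P (f x)) - snd (a x)"
        "fst (b x) - fst (\<xi> (f x) - P (f x)) = fst (P (f x)) - fst (a x)"
      using elim(1) by simp_all
    have wP: "w1 x * snd (P (f x)) - w2 x * fst (P (f x)) = (x - s0) ^ (2 * l) * poly Q (x - s0)"
      unfolding elim(3) Pf by (simp add: Q_def w1_def w2_def algebra_simps)
    show ?case unfolding diffs wP[symmetric] using wa by (simp add: algebra_simps)
  qed
  have w: "w1 \<in> O[nhds s0](\<lambda>_. 1)" "w2 \<in> O[nhds s0](\<lambda>_. 1)"
  proof -
    have "w1 = (\<lambda>x. poly [:2 * c, - 3 * s:] (x - s0))" "w2 = (\<lambda>x. poly [:2 * s, 3 * c:] (x - s0))"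
      by (auto simp: w1_def w2_def algebra_simps)
    then have "germS {s0} w1" "germS {s0} w2"
      unfolding germS_def using smooth1_on_poly by (metis subset_UNIV)+
    then show "w1 \<in> O[nhds s0](\<lambda>_. 1)" "w2 \<in> O[nhds s0](\<lambda>_. 1)"
      using germS_bounded by blast+
  qed
  have r: "(\<lambda>x. fst (\<xi> (f x) - P (f x))) \<in> O[nhds s0](\<lambda>x. (x - s0) ^ (2 * Suc l))"
      "(\<lambda>x. snd (\<xi> (f x) - P (f x))) \<in> O[nhds s0](\<lambda>x. (x - s0) ^ (2 * Suc l))"
    using P(2) mpow_comp_cusp_bigo[OF _ f] unfolding mpow_vf_def by fastforce+
  note b' = pullback_mod_bigo[OF b s0 f]
  \<comment> \<open>Both b and the remainder of \<xi> have order 2l + 2, two more than the factor in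
    front of Q: exactly the two lowest coefficients of Q are forced to vanish.\<close>
  have "(\<lambda>x. w1 x * (snd (b x) - snd (\<xi> (f x) - P (f x))) - w2 x * (fst (b x) - fst (\<xi> (f x) - P (f x))))
      \<in> O[nhds s0](\<lambda>x. 1 * (x - s0) ^ (2 * Suc l))"
    by (intro sum_in_bigo landau_o.big.mult w r b')
  then have "(\<lambda>x. (x - s0) ^ (2 * l) * poly Q (x - s0)) \<in> O[nhds s0](\<lambda>x. (x - s0) ^ (2 * l + 2))"
    by (simp add: landau_o.big.in_cong[OF eq])
  from poly_low_coeffs_if_bigo[OF this] have "coeff Q 0 = 0" "coeff Q 1 = 0" .
  moreover have "coeff Q 0 = 2 * (c * snd (P (c, s)) - s * fst (P (c, s)))"
    by (simp add: Q_def q1 q2 algebra_simps)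
  moreover have "coeff Q 1 = 2 * (c * coeff q2 1 - s * coeff q1 1) - 3 * (c * coeff q1 0 + s * coeff q2 0)"
    by (simp add: Q_def algebra_simps)
  ultimately show ?thesis
    unfolding obstruction_dir_iff[OF P(1)] c_def[symmetric] s_def[symmetric] q1 q2 by simp
qed

text \<open>The converse computation: the two conditions make P(d + t n) tangent to the branch up to
  a remainder of order t^2, with an explicit multiplier \<alpha> + \<beta> t.\<close>

lemma branch_expansion:
  fixes P :: "'k::real_normed_field \<times> 'k \<Rightarrow> 'k \<times> 'k" and \<theta> :: real
  assumes P: "hom_vf l P" and obs: "obstruction l P (dir \<theta>) = 0"
  defines "c \<equiv> of_real (cos \<theta>)" and "s \<equiv> of_real (sin \<theta>)"
  shows "\<exists>\<alpha> \<beta> E1 E2. \<forall>t. P (c + t * - s, s + t * c) =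
    ((\<alpha> + \<beta> * t) * (2 * c - 3 * s * t) + t\<^sup>2 * poly E1 t, (\<alpha> + \<beta> * t) * (2 * s + 3 * c * t) + t\<^sup>2 * poly E2 t)"
proof -
  obtain q1 where q1: "coeff q1 0 = fst (P (c, s))"
    "coeff q1 1 = - s * pd1 (\<lambda>p. fst (P p)) (c, s) + c * pd2 (\<lambda>p. fst (P p)) (c, s)"
    "\<And>t. poly q1 t = fst (P (c + t * - s, s + t * c))"
    using P(1) hom_poly_on_line[of l "\<lambda>p. fst (P p)" "- s" c c s] unfolding hom_vf_def by metis
  obtain q2 where q2: "coeff q2 0 = snd (P (c, s))"
    "coeff q2 1 = - s * pd1 (\<lambda>p. snd (P p)) (c, s) + c * pd2 (\<lambda>p. snd (P p)) (c, s)"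
    "\<And>t. poly q2 t = snd (P (c + t * - s, s + t * c))"
    using P(1) hom_poly_on_line[of l "\<lambda>p. snd (P p)" "- s" c c s] unfolding hom_vf_def by metis
  obtain a1 b1 R1 a2 b2 R2 where R: "q1 = pCons a1 (pCons b1 R1)" "q2 = pCons a2 (pCons b2 R2)"
    by (metis pCons_cases)
  have cs: "c\<^sup>2 + s\<^sup>2 = 1" unfolding c_def s_def by (rule dir_norm)
  have co: "coeff q1 0 = a1" "coeff q1 1 = b1" "coeff q2 0 = a2" "coeff q2 1 = b2" by (simp_all add: R)
  have cond: "c * a2 - s * a1 = 0" "2 * (c * b2 - s * b1) = 3 * (c * a1 + s * a2)"
    using obs unfolding obstruction_dir_iff[OF P(1)] c_def[symmetric] s_def[symmetric]
      q1(1,2)[symmetric] q2(1,2)[symmetric] co by simp_all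
  \<comment> \<open>Matching a + b t with (\<alpha> + \<beta> t) (2 d + 3 t n) requires a = 2
    \<alpha> d and b = 2 \<beta> d + 3 \<alpha> n. The components along d determine \<alpha> and
    \<beta>; the normal components are the conditions in \<open>cond\<close>.\<close>
  define \<alpha> \<beta> where "\<alpha> = (c * a1 + s * a2) / 2" and "\<beta> = (c * b1 + s * b2) / 2"
  have \<alpha>\<beta>: "2 * \<alpha> = c * a1 + s * a2" "2 * \<beta> = c * b1 + s * b2" by (simp_all add: \<alpha>_def \<beta>_def)
  have a: "a1 = 2 * c * \<alpha>" "a2 = 2 * s * \<alpha>" using \<alpha>\<beta> cond cs by algebra+
  have "2 * b1 = 2 * (2 * c * \<beta> - 3 * s * \<alpha>)" "2 * b2 = 2 * (2 * s * \<beta> + 3 * c * \<alpha>)"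
    using \<alpha>\<beta> cond cs by algebra+
  then have b: "b1 = 2 * c * \<beta> - 3 * s * \<alpha>" "b2 = 2 * s * \<beta> + 3 * c * \<alpha>"
    by (simp_all only: mult_left_cancel[OF zero_neq_numeral[symmetric]])
  \<comment> \<open>The constants added to \<open>R1\<close> and \<open>R2\<close> compensate the
    term 3 \<beta> t^2 n of the product.\<close>
  have "P (c + t * - s, s + t * c) = ((\<alpha> + \<beta> * t) * (2 * c - 3 * s * t) + t\<^sup>2 * poly (R1 + [:3 * s * \<beta>:]) t,
      (\<alpha> + \<beta> * t) * (2 * s + 3 * c * t) + t\<^sup>2 * poly (R2 + [:- 3 * c * \<beta>:]) t)" for t
    unfolding prod_eq_iff q1(3)[symmetric] q2(3)[symmetric] R
    by (simp add: a b power2_eq_square algebra_simps)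
  then show ?thesis by blast
qed

text \<open>On the branch with angle \<^term>\<open>\<theta>\<close>, the \<open>l\<close>-th power of the linear form dual to \<^term>\<open>dir \<theta>\<close> pulls back
  to the \<open>2l\<close>-th power of the local parameter.\<close>

lemma pullback_modI:
  fixes f :: "'k::real_normed_field \<Rightarrow> 'k \<times> 'k" and s :: "nat \<Rightarrow> 'k" and \<theta> :: "nat \<Rightarrow> real"
  assumes J: "finite J" "inj_on s J"
    and f: "\<And>k. k \<in> J \<Longrightarrow> \<forall>\<^sub>F x in nhds (s k). f x = cusp_branch (\<theta> k) (s k) x"
    and w: "\<And>k. k \<in> J \<Longrightarrow> \<forall>\<^sub>F x in nhds (s k).
      w x = ((x - s k) ^ (2 * l) * poly (A k) (x - s k), (x - s k) ^ (2 * l) * poly (B k) (x - s k))"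
  shows "w \<in> pullback_mod l (s ` J) f"
proof -
  obtain \<kappa> where \<kappa>: "\<And>k. k \<in> J \<Longrightarrow> \<forall>\<^sub>F x in nhds (s k). \<kappa> x = k" using index_near_finite_points[OF J] by blast
  obtain N :: nat where N: "\<And>k. k \<in> J \<Longrightarrow> k < N" using J(1) finite_nat_set_iff_bounded by auto
  define u :: "nat \<Rightarrow> 'k \<times> 'k \<Rightarrow> 'k"
    where "u k p = (of_real (cos (\<theta> k)) * fst p + of_real (sin (\<theta> k)) * snd p) ^ l" for k p
  \<comment> \<open>Supported near \<open>s k\<close> alone, so near each point of S one generator
    survives; indices below N outside J contribute zero there.\<close>
  define v where "v k x = (if \<kappa> x = k then (poly (A k) (x - s k), poly (B k) (x - s k)) else (0, 0))" for k x
  have "u k \<in> mpow l" for k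
    using hom_poly_mpow[OF hom_poly_prod[of "{..<l}" "\<lambda>_. of_real (cos (\<theta> k))" "\<lambda>_. of_real (sin (\<theta> k))"]]
    by (simp add: u_def[abs_def])
  moreover have "germS_vf (s ` J) (v k)" for k
  proof -
    have "\<forall>\<^sub>F x in nhds (s m). fst (v k x) = poly (if m = k then A k else 0) (x - s k)"
      "\<forall>\<^sub>F x in nhds (s m). snd (v k x) = poly (if m = k then B k else 0) (x - s k)" if "m \<in> J" for m
      using \<kappa>[OF that] by (auto elim!: eventually_mono simp: v_def)
    then show ?thesis unfolding germS_vf_def by (intro conjI germS_if_locally_poly) blast+
  qed
  moreover have "\<forall>\<^sub>F x in nhds (s m). w x = (\<Sum>k<N. smult_pair (u k (f x)) (v k x))" if m: "m \<in> J" for m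
    using f[OF m] w[OF m] \<kappa>[OF m]
  proof eventually_elim
    case (elim x)
    define t where "t = x - s m"
    have "of_real (cos (\<theta> m)) * fst (f x) + of_real (sin (\<theta> m)) * snd (f x)
        = ((of_real (cos (\<theta> m)))\<^sup>2 + (of_real (sin (\<theta> m)))\<^sup>2) * t\<^sup>2"
      unfolding elim(1) cusp_branch_eq t_def[symmetric] by (simp add: power2_eq_square algebra_simps)
    then have "u m (f x) = t ^ (2 * l)" by (simp add: u_def dir_norm power_mult)
    then have "(\<Sum>k<N. smult_pair (u k (f x)) (v k x)) = (\<Sum>k<N. if k = m then w x else 0)"
      using elim by (intro sum.cong) (auto simp: v_def smult_pair_def t_def zero_prod_def)
    also have "\<dots> = w x" using N[OF m] by simp
    finally show ?case by simp
  qed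
  ultimately show ?thesis unfolding pullback_mod_def germ_eq_iff by blast
qed

lemma obstruction_zero_imp_ker_omega_bar:
  fixes f :: "'k::real_normed_field \<Rightarrow> 'k \<times> 'k" and s :: "nat \<Rightarrow> 'k" and \<theta> :: "nat \<Rightarrow> real"
  assumes J: "finite J" "inj_on s J"
    and f: "\<And>k. k \<in> J \<Longrightarrow> \<forall>\<^sub>F x in nhds (s k). f x = cusp_branch (\<theta> k) (s k) x"
    and P: "hom_vf (Suc l) P" and obs: "\<And>k. k \<in> J \<Longrightarrow> obstruction (Suc l) P (dir (\<theta> k)) = 0"
  shows "P \<in> ker_omega_bar (Suc l) (s ` J) f"
proof -
  define cs sn :: "nat \<Rightarrow> 'k" where "cs k = of_real (cos (\<theta> k))" and "sn k = of_real (sin (\<theta> k))" for k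
  have "\<forall>k\<in>J. \<exists>\<alpha> \<beta> E1 E2. \<forall>t. P (cs k + t * - sn k, sn k + t * cs k) =
      ((\<alpha> + \<beta> * t) * (2 * cs k - 3 * sn k * t) + t\<^sup>2 * poly E1 t, (\<alpha> + \<beta> * t) * (2 * sn k + 3 * cs k * t) + t\<^sup>2 * poly E2 t)"
    using branch_expansion[OF P obs] unfolding cs_def sn_def by blast
  then obtain \<alpha> \<beta> E1 E2 where E: "\<And>k t. k \<in> J \<Longrightarrow> P (cs k + t * - sn k, sn k + t * cs k) =
      ((\<alpha> k + \<beta> k * t) * (2 * cs k - 3 * sn k * t) + t\<^sup>2 * poly (E1 k) t,
       (\<alpha> k + \<beta> k * t) * (2 * sn k + 3 * cs k * t) + t\<^sup>2 * poly (E2 k) t)"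
    by metis
  obtain \<kappa> where \<kappa>: "\<And>k. k \<in> J \<Longrightarrow> \<forall>\<^sub>F x in nhds (s k). \<kappa> x = k" using index_near_finite_points[OF J] by blast
  \<comment> \<open>The derivative of the branch supplies one factor t, so the exponent 2 (l + 1) -
    1 brings \<open>tf f \<eta>\<close> to order 2 (l + 1). It is a natural number because the
    degree is at least 1.\<close>
  define \<eta> where "\<eta> x = (x - s (\<kappa> x)) ^ (2 * l + 1) * (\<alpha> (\<kappa> x) + \<beta> (\<kappa> x) * (x - s (\<kappa> x)))" for x
  define b where "b x = P (f x) - tf f \<eta> x" for x
  have \<eta>: "\<forall>\<^sub>F x in nhds (s k). \<eta> x = (x - s k) ^ (2 * l + 1) * (\<alpha> k + \<beta> k * (x - s k))" if "k \<in> J" for k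
    using \<kappa>[OF that] by (auto elim!: eventually_mono simp: \<eta>_def)
  have tf: "\<forall>\<^sub>F x in nhds (s k). tf f \<eta> x =
      ((x - s k) ^ (2 * Suc l) * ((\<alpha> k + \<beta> k * (x - s k)) * (2 * cs k - 3 * sn k * (x - s k))),
       (x - s k) ^ (2 * Suc l) * ((\<alpha> k + \<beta> k * (x - s k)) * (2 * sn k + 3 * cs k * (x - s k))))" if k: "k \<in> J" for k
    using tf_cusp_branch[OF f[OF k], of \<eta>] \<eta>[OF k]
    by eventually_elim (simp add: cs_def sn_def)
  \<comment> \<open>Tangency alone does not suffice: the kernel asks for an element of the
    intersection with the pulled back module.\<close>
  have "tf f \<eta> \<in> pullback_mod (Suc l) (s ` J) f"
  proof (rule pullback_modI[OF J f, where A = "\<lambda>k. [:\<alpha> k, \<beta> k:] * [:2 * cs k, - 3 * sn k:]"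
          and B = "\<lambda>k. [:\<alpha> k, \<beta> k:] * [:2 * sn k, 3 * cs k:]"])
    fix k assume k: "k \<in> J"
    have "poly ([:\<alpha> k, \<beta> k:] * [:2 * cs k, - 3 * sn k:]) t = (\<alpha> k + \<beta> k * t) * (2 * cs k - 3 * sn k * t)"
        "poly ([:\<alpha> k, \<beta> k:] * [:2 * sn k, 3 * cs k:]) t = (\<alpha> k + \<beta> k * t) * (2 * sn k + 3 * cs k * t)" for t
      by (simp_all add: algebra_simps)
    then show "\<forall>\<^sub>F x in nhds (s k). tf f \<eta> x =
        ((x - s k) ^ (2 * Suc l) * poly ([:\<alpha> k, \<beta> k:] * [:2 * cs k, - 3 * sn k:]) (x - s k),
         (x - s k) ^ (2 * Suc l) * poly ([:\<alpha> k, \<beta> k:] * [:2 * sn k, 3 * cs k:]) (x - s k))"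
      using tf[OF k] by (simp only:)
  qed
  moreover have "germS (s ` J) \<eta>"
  proof (rule germS_if_locally_poly, elim imageE)
    fix y k assume k: "k \<in> J" "y = s k"
    have "poly (monom 1 (2 * l + 1) * [:\<alpha> k, \<beta> k:]) t = t ^ (2 * l + 1) * (\<alpha> k + \<beta> k * t)" for t
      by (simp add: poly_monom algebra_simps)
    then have "\<forall>\<^sub>F x in nhds y. \<eta> x = poly (monom 1 (2 * l + 1) * [:\<alpha> k, \<beta> k:]) (x - s k)"
      unfolding k(2) using \<eta>[OF k(1)] by (simp only:)
    then show "\<exists>q c. \<forall>\<^sub>F x in nhds y. \<eta> x = poly q (x - c)" by blast
  qed
  then have "tf f \<eta> \<in> TRe (s ` J) f" unfolding TRe_def germ_eq_iff by auto
  \<comment> \<open>The remainder t^2 E of the expansion, times t^(2 (l + 1)), is what raises the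
    order to the next graded level.\<close>
  moreover have "b \<in> pullback_mod (Suc (Suc l)) (s ` J) f"
  proof (rule pullback_modI[OF J f, where A = E1 and B = E2])
    fix k assume k: "k \<in> J"
    show "\<forall>\<^sub>F x in nhds (s k). b x = ((x - s k) ^ (2 * Suc (Suc l)) * poly (E1 k) (x - s k),
        (x - s k) ^ (2 * Suc (Suc l)) * poly (E2 k) (x - s k))"
      using tf[OF k] f[OF k]
    proof eventually_elim
      case (elim x)
      have "fst (P (f x)) = (x - s k) ^ (2 * Suc l) * fst (P (cs k + (x - s k) * - sn k, sn k + (x - s k) * cs k))"
        "snd (P (f x)) = (x - s k) ^ (2 * Suc l) * snd (P (cs k + (x - s k) * - sn k, sn k + (x - s k) * cs k))"
        unfolding elim(2) cs_def sn_def using P hom_poly_cusp_branch[of "Suc l"] unfolding hom_vf_def by blast+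
      then show ?case
        unfolding b_def elim(1) E[OF k] prod_eq_iff by (simp add: power_add power2_eq_square algebra_simps)
    qed
  qed
  moreover have "germ_eq (s ` J) (\<lambda>x. P (f x)) (\<lambda>x. tf f \<eta> x + b x)"
    unfolding germ_eq_iff b_def by simp
  ultimately show ?thesis
    unfolding ker_omega_bar_def using hom_vf_mpow_vf[OF P] by blast
qed

section \<open>From angles to the multicusp\<close>

lemma cross2_dir: "cross2 (dir \<theta>) (dir \<phi>) = of_real (sin (\<phi> - \<theta>))"
  by (simp add: cross2_def dir_def sin_diff algebra_simps)

text \<open>Two angles in the given range differ by less than 2 pi, so 0 and plus or minus pi are
  the only zeros of the sine to exclude: the tangent lines are distinct.\<close>

lemma sin_diff_nonzero:
  assumes "0 \<le> a" "a < 2 * pi" "0 \<le> b" "b < 2 * pi" "a \<noteq> b" "\<bar>a - b\<bar> \<noteq> pi"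
  shows "sin (b - a) \<noteq> 0"
proof -
  have "sin x \<noteq> 0" if "0 < x" "x < 2 * pi" "x \<noteq> pi" for x :: real
    using sin_gt_zero[of x] sin_lt_zero[of x] that by (cases "x < pi") auto
  from this[of "b - a"] this[of "a - b"] show ?thesis
    using assms sin_minus[of "b - a"] by (cases "a < b") auto
qed

text \<open>Valid over any real normed field, so the real and the complex case are both instances of
  it.\<close>

lemma multicusp_graded_direct_sum:
  fixes s :: "nat \<Rightarrow> 'k::real_normed_field"
  assumes "i \<ge> 1"
    and range: "\<forall>j\<le>i. 0 \<le> \<theta> j \<and> \<theta> j < 2 * pi"
    and distinct: "\<forall>j\<le>i. \<forall>k\<le>i. j \<noteq> k \<longrightarrow> \<theta> j \<noteq> \<theta> k \<and> \<bar>\<theta> j - \<theta> k\<bar> \<noteq> pi"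
    and inj: "inj_on s {0..i}" and f: "multicusp_rep i \<theta> s f"
  shows "graded_direct_sum i (\<lambda>j. ker_omega_bar i (s ` ({0..i} - {j})) f) {0..i}"
proof -
  obtain l where l: "i = Suc l" using assms(1) by (cases i) auto
  have f': "\<forall>\<^sub>F x in nhds (s k). f x = cusp_branch (\<theta> k) (s k) x" if "k \<le> i" for k
    using f that unfolding multicusp_rep_def by blast
  show ?thesis
  proof (rule graded_direct_sum_if_obstruction[OF l, where d = "\<lambda>k. dir (\<theta> k)"])
    fix j k assume "j \<le> i" "k \<le> i" "j \<noteq> k"
    then show "cross2 (dir (\<theta> j)) (dir (\<theta> k)) \<noteq> (0::'k)"
      using sin_diff_nonzero[of "\<theta> j" "\<theta> k"] range distinct by (simp add: cross2_dir)
  next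
    fix k
    show "dir (\<theta> k) \<noteq> (0::'k, 0)"
      by (auto simp: dir_def dest: sin_zero_abs_cos_one)
  next
    fix j
    show "ker_omega_bar i (s ` ({0..i} - {j})) f \<subseteq> mpow_vf i" unfolding ker_omega_bar_def by blast
  next
    fix j k \<xi> P
    assume "\<xi> \<in> ker_omega_bar i (s ` ({0..i} - {j})) f" "hom_vf i P" "(\<lambda>p. \<xi> p - P p) \<in> mpow_vf (Suc i)" "k \<le> i" "k \<noteq> j"
    then show "obstruction i P (dir (\<theta> k)) = 0"
      using f' by (intro ker_omega_bar_imp_obstruction_zero[where ?s0.0 = "s k"]) auto
  next
    fix j and P :: "'k \<times> 'k \<Rightarrow> 'k \<times> 'k"
    assume "hom_vf i P" "\<And>k. k \<le> i \<Longrightarrow> k \<noteq> j \<Longrightarrow> obstruction i P (dir (\<theta> k)) = 0"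
    then show "P \<in> ker_omega_bar i (s ` ({0..i} - {j})) f"
      using f' inj_on_subset[OF inj, of "{0..i} - {j}"] obstruction_zero_imp_ker_omega_bar[of "{0..i} - {j}" s f \<theta> l P] l
      by auto
  qed
qed

theorem theorem2:
  fixes i :: nat and \<theta> :: "nat \<Rightarrow> real"
  assumes "i \<ge> 1"
    and "\<forall>j\<le>i. 0 \<le> \<theta> j \<and> \<theta> j < 2 * pi"
    and "\<forall>j\<le>i. \<forall>k\<le>i. j \<noteq> k \<longrightarrow> \<theta> j \<noteq> \<theta> k \<and> \<bar>\<theta> j - \<theta> k\<bar> \<noteq> pi"
  shows "(\<forall>(s :: nat \<Rightarrow> real) (f :: real \<Rightarrow> real \<times> real).
            inj_on s {0..i} \<and> multicusp_rep i \<theta> s f \<longrightarrow>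
            graded_direct_sum i (\<lambda>j. ker_omega_bar i (s ` ({0..i} - {j})) f) {0..i})
       \<and> (\<forall>(s :: nat \<Rightarrow> complex) (f :: complex \<Rightarrow> complex \<times> complex).
            inj_on s {0..i} \<and> multicusp_rep i \<theta> s f \<longrightarrow>
            graded_direct_sum i (\<lambda>j. ker_omega_bar i (s ` ({0..i} - {j})) f) {0..i})"
  by (intro conjI allI impI; elim conjE; rule multicusp_graded_direct_sum[OF assms])

end
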